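(* Let $a<b$ be real numbers and $n\in\mathbb{N}$. If $f\in C^n([a,b])$ (a real function on the real interval $[a,b]$) and if $f$ is not locally analytic at any point of $[a,b]$, then the order $n$ extension $\overline{f}_n$ of $f$ does not belong to $\mathcal{M}(A)$ for any measurable set $A\subseteq[a,b]_{\mathcal{R}}$ whose measure $m(A)$ is not infinitesimal.
   Context: A set $F\subset\mathbb{Q}$ is left-finite if $\{x\in F: x\le q\}$ is finite for every $q\in\mathbb{Q}$. The Levi-Civita field $\mathcal{R}$ is the set of functions $x:\mathbb{Q}\to\mathbb{R}$ (values written $x[q]$) whose support $\{q: x[q]\neq 0\}$ is left-finite, with pointwise sum and product $(x\cdot y)[q]=\sum_{q_1+q_2=q}x[q_1]y[q_2]$. For $x\ne 0$, $\lambda(x)=\min\operatorname{supp}(x)$, and $\lambda(0)=\infty$. For $x\neq y$, $x<y$ iff $(x-y)[\lambda(x-y)]<0$. This makes $\mathcal{R}$ an ordered field containing $\mathbb{R}$. An element $x$ is infinitesimal if $\lambda(x)>0$. $[a,b]_{\mathcal{R}}=\{x\in\mathcal{R}:a\le x\le b\}$. A sequence strongly converges to $l$ if for every $\varepsilon\in\mathcal{R}$, $\varepsilon>0$, eventually $|a_n-l|<\varepsilon$. It weakly converges to $l\in\mathcal{R}$ if for every real $\varepsilon>0$, eventually $\max_{q\in\mathbb{Q},q\le\varepsilon^{-1}}|(a_n-l)[q]|<\varepsilon$. For $a\le b$ in $\mathcal{R}$, $I(a,b)$ denotes any of the four intervals of $\mathcal{R}$ with endpoints $a,b$ (degenerate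 intervals allowed), with length $l(I(a,b))=b-a$. A set $A\subseteq\mathcal{R}$ is measurable iff for every $\varepsilon\in\mathcal{R}$, $\varepsilon>0$, there are two sequences of mutually disjoint intervals $\{I_n\}$, $\{J_n\}$ such that $\bigcup_n I_n\subseteq A\subseteq\bigcup_n J_n$, $\sum_n l(I_n)$ and $\sum_n l(J_n)$ strongly converge, and $\sum_n l(J_n)-\sum_n l(I_n)\le\varepsilon$. The measure $m(A)\in\mathcal{R}$ is the (existing) supremum of such inner sums, equal to the infimum of such outer sums. A function $f$ is simple on an interval $I$ if there are $x_0\in\mathcal{R}$ and $a_k\in\mathcal{R}$ such that for every $x\in I$ the partial sums $\sum_{k\le K}a_k(x-x_0)^k$ weakly converge to $f(x)$. For $A$ measurable, $f:A\to\mathcal{R}$ is measurable (written $f\in\mathcal{M}(A)$) iff for every $\varepsilon\in\mathcal{R}$, $\varepsilon>0$, there is a sequence of mutually disjoint intervals $\{I_n\}$ with $\bigcup_n I_n\subseteq A$, $\sum_n l(I_n)$ strongly convergent, $m(A)-\sum_n l(I_n)<\varepsilon$, and $f$ simple on each $I_n$. For $f\in C^n([a,b])$, the order $n$ extension $\overline{f}_n:[a,b]_{\mathcal{R}}\to\mathcal{R}$ is $\overline{f}_n(r+\varepsilon)=\sum_{i=0}^n f^{(i)}(r)\frac{\varepsilon^i}{i!}$ for $r\in[a,b]$ and $\varepsilon$ infinitesimal (possibly $0$) with $r+\varepsilon\in[a,b]_{\mathcal{R}}$; membership in $\mathcal{M}(A)$ refers to its restriction to $A$. A real function is locally analytic at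 $r$ if it coincides with a convergent real power series on a neighbourhood of $r$ in $[a,b]$. *)

theory Defs
  imports Complex_Main "HOL-Library.Extended" "HOL-Library.Disjoint_Sets"
begin

section \<open>The Levi-Civita field\<close>

definition left_finite :: "rat set \<Rightarrow> bool" where
  "left_finite F \<longleftrightarrow> (\<forall>q. finite {x \<in> F. x \<le> q})"

lemma left_finite_subset: "left_finite F \<Longrightarrow> G \<subseteq> F \<Longrightarrow> left_finite G"
  unfolding left_finite_def by (auto intro: finite_subset[rotated])

lemma left_finite_Un: "left_finite F \<Longrightarrow> left_finite G \<Longrightarrow> left_finite (F \<union> G)"
  unfolding left_finite_def
proof
  fix q assume "\<forall>q. finite {x \<in> F. x \<le> q}" "\<forall>q. finite {x \<in> G. x \<le> q}"
  moreover have "{x \<in> F \<union> G. x \<le> q} = {x \<in> F. x \<le> q} \<union> {x \<in> G. x \<le> q}" by auto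
  ultimately show "finite {x \<in> F \<union> G. x \<le> q}" by simp
qed

lemma left_finite_finite: "finite F \<Longrightarrow> left_finite F"
  unfolding left_finite_def by auto

lemma left_finite_bdd_below:
  assumes "left_finite F" shows "\<exists>m. \<forall>x\<in>F. m \<le> x"
proof (cases "F = {}")
  case False
  then obtain y where y: "y \<in> F" by auto
  let ?S = "{x \<in> F. x \<le> y}"
  have fin: "finite ?S" using assms by (auto simp: left_finite_def)
  have "Min ?S \<le> x" if "x \<in> F" for x
  proof (cases "x \<le> y")
    case True then show ?thesis using fin that by (intro Min_le) auto
  next
    case False
    have "Min ?S \<le> y" using fin y by (intro Min_le) auto
    then show ?thesis using False by simp
  qed
  then show ?thesis by blast
qed auto

text \<open>The value written \<open>x[q]\<close> on paper is \<open>lc_nth x q\<close>.\<close>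

typedef levi_civita = "{x :: rat \<Rightarrow> real. left_finite {q. x q \<noteq> 0}}"
  morphisms lc_nth Abs_lc
  by (rule exI[of _ "\<lambda>_. 0"]) (simp add: left_finite_finite)

setup_lifting type_definition_levi_civita

abbreviation lc_supp :: "levi_civita \<Rightarrow> rat set" where
  "lc_supp x \<equiv> {q. lc_nth x q \<noteq> 0}"

lemma left_finite_supp: "left_finite (lc_supp x)"
  using lc_nth[of x] by simp

lemma finite_supp_le: "finite {q. lc_nth x q \<noteq> 0 \<and> q \<le> B}"
  using left_finite_supp[of x] by (auto simp: left_finite_def)

lemma lc_eq_iff: "x = y \<longleftrightarrow> (\<forall>q. lc_nth x q = lc_nth y q)"
  by (simp add: lc_nth_inject[symmetric] fun_eq_iff)

lemma left_finite_pairs: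
  assumes "left_finite F" "left_finite G"
  shows "finite {(p, r). p \<in> F \<and> r \<in> G \<and> p + r \<le> (q::rat)}"
proof -
  obtain m k where m: "\<forall>x\<in>F. m \<le> x" and k: "\<forall>x\<in>G. k \<le> x"
    using left_finite_bdd_below assms by meson
  have "{(p, r). p \<in> F \<and> r \<in> G \<and> p + r \<le> q} \<subseteq> {x \<in> F. x \<le> q - k} \<times> {x \<in> G. x \<le> q - m}"
    using m k by (auto; smt (verit) add.commute add_le_cancel_right diff_add_cancel le_diff_eq order_trans add_mono)
  moreover have "finite ({x \<in> F. x \<le> q - k} \<times> {x \<in> G. x \<le> q - m})"
    using assms by (auto simp: left_finite_def)
  ultimately show ?thesis by (rule finite_subset)
qed

lemma left_finite_sums:
  assumes "left_finite F" "left_finite G"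
  shows "left_finite {p + r | p r. p \<in> F \<and> r \<in> G}"
  unfolding left_finite_def
proof
  fix q
  have "{x \<in> {p + r | p r. p \<in> F \<and> r \<in> G}. x \<le> q}
      = (\<lambda>(p, r). p + r) ` {(p, r). p \<in> F \<and> r \<in> G \<and> p + r \<le> q}"
    by auto
  then show "finite {x \<in> {p + r | p r. p \<in> F \<and> r \<in> G}. x \<le> q}"
    using left_finite_pairs[OF assms] by simp
qed

text \<open>The index set of the convolution sum is restricted to the supports, where it is finite.\<close>

instantiation levi_civita :: comm_ring_1
begin

lift_definition zero_levi_civita :: levi_civita is "\<lambda>_. 0"
  by (simp add: left_finite_finite)

lift_definition one_levi_civita :: levi_civita is "\<lambda>q. if q = 0 then 1 else 0"
  by (simp add: left_finite_finite)

lift_definition plus_levi_civita :: "levi_civita \<Rightarrow> levi_civita \<Rightarrow> levi_civita"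
  is "\<lambda>x y q. x q + y q"
  by (erule (1) left_finite_subset[OF left_finite_Un]) auto

lift_definition minus_levi_civita :: "levi_civita \<Rightarrow> levi_civita \<Rightarrow> levi_civita"
  is "\<lambda>x y q. x q - y q"
  by (erule (1) left_finite_subset[OF left_finite_Un]) auto

lift_definition uminus_levi_civita :: "levi_civita \<Rightarrow> levi_civita"
  is "\<lambda>x q. - x q"
  by simp

lift_definition times_levi_civita :: "levi_civita \<Rightarrow> levi_civita \<Rightarrow> levi_civita"
  is "\<lambda>x y q. \<Sum>(q1, q2) | x q1 \<noteq> 0 \<and> y q2 \<noteq> 0 \<and> q1 + q2 = q. x q1 * y q2"
proof -
  fix x y :: "rat \<Rightarrow> real"
  assume *: "left_finite {q. x q \<noteq> 0}" "left_finite {q. y q \<noteq> 0}"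
  show "left_finite {q. (\<Sum>(q1, q2) | x q1 \<noteq> 0 \<and> y q2 \<noteq> 0 \<and> q1 + q2 = q. x q1 * y q2) \<noteq> 0}"
  proof (rule left_finite_subset[OF left_finite_sums[OF *]], safe)
    fix q assume "(\<Sum>(q1, q2) | x q1 \<noteq> 0 \<and> y q2 \<noteq> 0 \<and> q1 + q2 = q. x q1 * y q2) \<noteq> 0"
    then obtain z where "z \<in> {(q1, q2). x q1 \<noteq> 0 \<and> y q2 \<noteq> 0 \<and> q1 + q2 = q}"
      by (meson sum.not_neutral_contains_not_neutral)
    then show "\<exists>p r. q = p + r \<and> p \<in> {q. x q \<noteq> 0} \<and> r \<in> {q. y q \<noteq> 0}" by auto
  qed
qed

lemma lc_mult_nth:
  assumes "finite S" and "\<And>p. lc_nth x p \<noteq> 0 \<Longrightarrow> lc_nth y (q - p) \<noteq> 0 \<Longrightarrow> p \<in> S"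
  shows "lc_nth (x * y) q = (\<Sum>p\<in>S. lc_nth x p * lc_nth y (q - p))"
proof -
  let ?T = "{p. lc_nth x p \<noteq> 0 \<and> lc_nth y (q - p) \<noteq> 0}"
  have "lc_nth (x * y) q = (\<Sum>p\<in>?T. lc_nth x p * lc_nth y (q - p))"
    unfolding times_levi_civita.rep_eq
    by (rule sum.reindex_bij_witness[of _ "\<lambda>p. (p, q - p)" fst]) auto
  also have "\<dots> = (\<Sum>p\<in>S. lc_nth x p * lc_nth y (q - p))"
    using assms by (intro sum.mono_neutral_left) auto
  finally show ?thesis .
qed

lemma lc_mult_commute: "x * y = y * (x::levi_civita)"
  unfolding lc_eq_iff times_levi_civita.rep_eq
  by (intro allI sum.reindex_bij_witness[of _ "\<lambda>(a,b). (b,a)" "\<lambda>(a,b). (b,a)"]) auto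

lemma lc_mult_index_finite: "finite {p. lc_nth x p \<noteq> 0 \<and> lc_nth y (q - p) \<noteq> 0}"
proof -
  have "{p. lc_nth x p \<noteq> 0 \<and> lc_nth y (q - p) \<noteq> 0}
      \<subseteq> fst ` {(p, r). p \<in> lc_supp x \<and> r \<in> lc_supp y \<and> p + r \<le> q}"
    by (force simp: image_iff)
  then show ?thesis
    using left_finite_pairs[OF left_finite_supp left_finite_supp] by (meson finite_imageI finite_subset)
qed

lemma lc_mult_assoc: "(x * y) * z = x * (y * (z::levi_civita))"
  unfolding lc_eq_iff
proof
  fix q
  obtain mx my mz where m: "\<forall>p\<in>lc_supp x. mx \<le> p" "\<forall>p\<in>lc_supp y. my \<le> p" "\<forall>p\<in>lc_supp z. mz \<le> p"
    using left_finite_bdd_below left_finite_supp by meson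
  define X where "X = {p. lc_nth x p \<noteq> 0 \<and> p \<le> q - my - mz}"
  define Y where "Y = {p. lc_nth y p \<noteq> 0 \<and> p \<le> q - mx - mz}"
  define S where "S = (\<lambda>(p, s). p + s) ` (X \<times> Y)"
  have fin: "finite X" "finite Y" "finite S"
    unfolding X_def Y_def S_def using finite_supp_le by auto
  have S: "lc_nth (x * y) r = (\<Sum>p\<in>X. lc_nth x p * lc_nth y (r - p))" if "lc_nth z (q - r) \<noteq> 0" for r
  proof (rule lc_mult_nth[OF fin(1)])
    fix p assume "lc_nth x p \<noteq> 0" "lc_nth y (r - p) \<noteq> 0"
    moreover have "mz \<le> q - r" "my \<le> r - p" using m that calculation by auto
    ultimately show "p \<in> X" by (auto simp: X_def)
  qed
  have "lc_nth (x * y * z) q = (\<Sum>r\<in>S. lc_nth (x * y) r * lc_nth z (q - r))"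
  proof (rule lc_mult_nth[OF fin(3)])
    fix r assume r: "lc_nth (x * y) r \<noteq> 0" "lc_nth z (q - r) \<noteq> 0"
    then obtain p where p: "p \<in> X" "lc_nth y (r - p) \<noteq> 0"
      using S by (metis (no_types, lifting) mult_eq_0_iff sum.neutral)
    then have "mz \<le> q - r" "mx \<le> p" using m r by (auto simp: X_def)
    then have "r - p \<in> Y" using p by (auto simp: Y_def)
    then show "r \<in> S" using p unfolding S_def by (intro image_eqI[of _ _ "(p, r - p)"]) auto
  qed
  also have "\<dots> = (\<Sum>r\<in>S. (\<Sum>p\<in>X. lc_nth x p * lc_nth y (r - p)) * lc_nth z (q - r))"
    by (intro sum.cong refl) (metis S mult_zero_right)
  also have "\<dots> = (\<Sum>p\<in>X. lc_nth x p * (\<Sum>r\<in>S. lc_nth y (r - p) * lc_nth z (q - r)))"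
    by (simp add: sum_distrib_left sum_distrib_right mult.assoc) (rule sum.swap)
  also have "\<dots> = (\<Sum>p\<in>X. lc_nth x p * lc_nth (y * z) (q - p))"
  proof (intro sum.cong refl arg_cong2[where f="(*)"])
    fix p assume p: "p \<in> X"
    have "lc_nth (y * z) (q - p) = (\<Sum>s\<in>(\<lambda>r. r - p) ` S. lc_nth y s * lc_nth z (q - p - s))"
    proof (rule lc_mult_nth)
      fix s assume s: "lc_nth y s \<noteq> 0" "lc_nth z (q - p - s) \<noteq> 0"
      then have "mz \<le> q - p - s" "mx \<le> p" using m p by (auto simp: X_def)
      then have "s \<in> Y" using s by (auto simp: Y_def)
      then have "p + s \<in> S" using p by (auto simp: S_def)
      then show "s \<in> (\<lambda>r. r - p) ` S" by (auto simp: image_iff intro!: bexI[of _ "p + s"])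
    qed (use fin in auto)
    also have "\<dots> = (\<Sum>r\<in>S. lc_nth y (r - p) * lc_nth z (q - r))"
      by (subst sum.reindex) (auto simp: inj_on_def)
    finally show "(\<Sum>r\<in>S. lc_nth y (r - p) * lc_nth z (q - r)) = lc_nth (y * z) (q - p)" by simp
  qed
  also have "\<dots> = lc_nth (x * (y * z)) q"
  proof (rule lc_mult_nth[OF fin(1), symmetric])
    fix p assume p: "lc_nth x p \<noteq> 0" "lc_nth (y * z) (q - p) \<noteq> 0"
    then obtain s where "lc_nth y s \<noteq> 0" "lc_nth z (q - p - s) \<noteq> 0"
      using lc_mult_nth[OF lc_mult_index_finite, of y z "q - p" y z "q - p"]
      by (metis (mono_tags, lifting) lc_mult_index_finite lc_mult_nth mem_Collect_eq mult_eq_0_iff sum.neutral)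
    then have "my \<le> s" "mz \<le> q - p - s" using m by auto
    then show "p \<in> X" using p by (auto simp: X_def)
  qed
  finally show "lc_nth (x * y * z) q = lc_nth (x * (y * z)) q" .
qed

instance
proof
  fix a b c :: levi_civita
  show "a * b * c = a * (b * c)" by (rule lc_mult_assoc)
  show "a * b = b * a" by (rule lc_mult_commute)
  show "a + b + c = a + (b + c)" by transfer (simp add: add.assoc)
  show "a + b = b + a" by transfer (simp add: add.commute)
  show "0 + a = a" by transfer simp
  show "- a + a = 0" by transfer simp
  show "a - b = a + - b" by transfer simp
  show "(0::levi_civita) \<noteq> 1" by transfer (auto simp: fun_eq_iff)
  show "1 * a = a"
    unfolding lc_eq_iff
  proof
    fix q show "lc_nth (1 * a) q = lc_nth a q"
      by (subst lc_mult_nth[of "{0}"]) (auto simp: one_levi_civita.rep_eq split: if_splits)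
  qed
  show "(a + b) * c = a * c + b * c"
    unfolding lc_eq_iff
  proof
    fix q
    let ?S = "{p. lc_nth a p \<noteq> 0 \<and> lc_nth c (q - p) \<noteq> 0} \<union> {p. lc_nth b p \<noteq> 0 \<and> lc_nth c (q - p) \<noteq> 0}"
    have fin: "finite ?S" using lc_mult_index_finite by auto
    show "lc_nth ((a + b) * c) q = lc_nth (a * c + b * c) q"
      unfolding plus_levi_civita.rep_eq
      by (subst (1 2 3) lc_mult_nth[OF fin])
         (auto simp: plus_levi_civita.rep_eq sum.distrib distrib_right)
  qed
qed

end

lemmas lc_nth_simps [simp] =
  zero_levi_civita.rep_eq one_levi_civita.rep_eq plus_levi_civita.rep_eq
  minus_levi_civita.rep_eq uminus_levi_civita.rep_eq

lemma lc_nth_sum [simp]: "lc_nth (sum g A) q = (\<Sum>i\<in>A. lc_nth (g i) q)"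
  by (induction A rule: infinite_finite_induct) auto


subsection \<open>Real scalars\<close>

instantiation levi_civita :: real_algebra_1
begin

lift_definition scaleR_levi_civita :: "real \<Rightarrow> levi_civita \<Rightarrow> levi_civita"
  is "\<lambda>c x q. c * x q"
  by (rule left_finite_subset) auto

instance
proof
  fix a b :: real and x y :: levi_civita
  show "a *\<^sub>R (x + y) = a *\<^sub>R x + a *\<^sub>R y" by transfer (simp add: distrib_left)
  show "(a + b) *\<^sub>R x = a *\<^sub>R x + b *\<^sub>R x" by transfer (simp add: distrib_right)
  show "a *\<^sub>R b *\<^sub>R x = (a * b) *\<^sub>R x" by transfer (simp add: mult.assoc)
  show "1 *\<^sub>R x = x" by transfer simp
  have *: "a *\<^sub>R x * y = a *\<^sub>R (x * y)" for x y :: levi_civita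
    unfolding lc_eq_iff
  proof
    fix q
    show "lc_nth (a *\<^sub>R x * y) q = lc_nth (a *\<^sub>R (x * y)) q"
      unfolding scaleR_levi_civita.rep_eq
      by (subst (1 2) lc_mult_nth[OF lc_mult_index_finite[of x y q]])
         (auto simp: scaleR_levi_civita.rep_eq sum_distrib_left mult.assoc)
  qed
  show "a *\<^sub>R x * y = a *\<^sub>R (x * y)" by (rule *)
  show "x * a *\<^sub>R y = a *\<^sub>R (x * y)" using *[of y x] by (simp add: mult.commute)
qed

end

declare scaleR_levi_civita.rep_eq [simp]

lemma lc_nth_of_real [simp]: "lc_nth (of_real r) q = (if q = 0 then r else 0)"
  by (simp add: of_real_def)


subsection \<open>Valuation and order\<close>

definition lc_lambda :: "levi_civita \<Rightarrow> rat extended" where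
  "lc_lambda x = (if x = 0 then Pinf else Fin (LEAST q. q \<in> lc_supp x))"

definition infinitesimal :: "levi_civita \<Rightarrow> bool" where
  "infinitesimal x \<longleftrightarrow> lc_lambda x > 0"

text \<open>\<open>lc_lead x\<close> is \<open>x[\<lambda>(x)]\<close>; the value at \<open>x = 0\<close> is irrelevant.\<close>

definition lc_lead :: "levi_civita \<Rightarrow> real" where
  "lc_lead x = (case lc_lambda x of Fin q \<Rightarrow> lc_nth x q | _ \<Rightarrow> 0)"

lemma lc_lambda_zero [simp]: "lc_lambda 0 = Pinf"
  by (simp add: lc_lambda_def)

lemma lc_lambda_eqI:
  assumes "lc_nth x q \<noteq> 0" "\<And>p. p < q \<Longrightarrow> lc_nth x p = 0"
  shows "lc_lambda x = Fin q"
proof -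
  have "(LEAST q. q \<in> lc_supp x) = q"
    using assms by (intro Least_equality) (auto simp: not_less[symmetric])
  moreover have "x \<noteq> 0" using assms by auto
  ultimately show ?thesis by (simp add: lc_lambda_def)
qed

lemma lc_lambda_obtain:
  assumes "x \<noteq> 0"
  obtains q where "lc_lambda x = Fin q" "lc_nth x q \<noteq> 0" "\<And>p. p < q \<Longrightarrow> lc_nth x p = 0"
proof -
  from assms obtain r where r: "lc_nth x r \<noteq> 0" by (auto simp: lc_eq_iff)
  let ?S = "{q. lc_nth x q \<noteq> 0 \<and> q \<le> r}"
  have fin: "finite ?S" by (rule finite_supp_le)
  define q where "q = Min ?S"
  have "q \<in> ?S" unfolding q_def using fin r by (intro Min_in) auto
  moreover have "lc_nth x p = 0" if "p < q" for p
    using Min_le[OF fin, of p] that \<open>q \<in> ?S\<close> unfolding q_def[symmetric] by force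
  ultimately show ?thesis using that[of q] lc_lambda_eqI[of x q] by auto
qed

lemma infinitesimal_iff: "infinitesimal x \<longleftrightarrow> (\<forall>q\<le>0. lc_nth x q = 0)"
proof (cases "x = 0")
  case False
  then obtain q where q: "lc_lambda x = Fin q" "lc_nth x q \<noteq> 0" "\<And>p. p < q \<Longrightarrow> lc_nth x p = 0"
    using lc_lambda_obtain by blast
  then show ?thesis
    unfolding infinitesimal_def zero_extended_def by (auto simp: not_less) (meson not_less order.strict_trans1)
qed (auto simp: infinitesimal_def zero_extended_def)

instantiation levi_civita :: linordered_idom
begin

definition less_levi_civita :: "levi_civita \<Rightarrow> levi_civita \<Rightarrow> bool" where
  "x < y \<longleftrightarrow> x \<noteq> y \<and> lc_lead (x - y) < 0"

definition less_eq_levi_civita :: "levi_civita \<Rightarrow> levi_civita \<Rightarrow> bool" where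
  "x \<le> y \<longleftrightarrow> x < y \<or> x = (y::levi_civita)"

definition abs_levi_civita :: "levi_civita \<Rightarrow> levi_civita" where
  "\<bar>x\<bar> = (if x < 0 then - x else (x::levi_civita))"

definition sgn_levi_civita :: "levi_civita \<Rightarrow> levi_civita" where
  "sgn x = (if x = (0::levi_civita) then 0 else if 0 < x then 1 else - 1)"

lemma lc_less_iff:
  "x < y \<longleftrightarrow> (\<exists>q. lc_nth x q < lc_nth y q \<and> (\<forall>p<q. lc_nth x p = lc_nth y p))"
proof
  assume "x < y"
  then have *: "x - y \<noteq> 0" "lc_lead (x - y) < 0" by (auto simp: less_levi_civita_def)
  then obtain q where "lc_lambda (x - y) = Fin q" "\<And>p. p < q \<Longrightarrow> lc_nth (x - y) p = 0"
    by (metis lc_lambda_obtain)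
  then show "\<exists>q. lc_nth x q < lc_nth y q \<and> (\<forall>p<q. lc_nth x p = lc_nth y p)"
    using * by (intro exI[of _ q]) (auto simp: lc_lead_def)
next
  assume "\<exists>q. lc_nth x q < lc_nth y q \<and> (\<forall>p<q. lc_nth x p = lc_nth y p)"
  then obtain q where "lc_nth x q < lc_nth y q" "\<forall>p<q. lc_nth x p = lc_nth y p" by blast
  moreover from this have "lc_lambda (x - y) = Fin q" by (intro lc_lambda_eqI) auto
  ultimately show "x < y" by (auto simp: less_levi_civita_def lc_lead_def)
qed

instance
proof
  fix x y z :: levi_civita
  have irr: "\<not> x < x" for x :: levi_civita by (simp add: less_levi_civita_def)
  have tr: "x < z" if "x < y" "y < z" for x y z :: levi_civita
  proof -
    from that obtain q r where
      q: "lc_nth x q < lc_nth y q" "\<forall>p<q. lc_nth x p = lc_nth y p" and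
      r: "lc_nth y r < lc_nth z r" "\<forall>p<r. lc_nth y p = lc_nth z p"
      by (auto simp: lc_less_iff)
    show ?thesis unfolding lc_less_iff
    proof (intro exI[of _ "min q r"] conjI allI impI)
      show "lc_nth x (min q r) < lc_nth z (min q r)"
        using q r by (cases q r rule: linorder_cases) (auto simp: min_def)
    qed (use q r in auto)
  qed
  show "x < y \<longleftrightarrow> x \<le> y \<and> \<not> y \<le> x" unfolding less_eq_levi_civita_def by (metis irr tr)
  show "x \<le> x" by (simp add: less_eq_levi_civita_def)
  show "x \<le> y \<Longrightarrow> y \<le> z \<Longrightarrow> x \<le> z" using tr unfolding less_eq_levi_civita_def by blast
  show "x \<le> y \<Longrightarrow> y \<le> x \<Longrightarrow> x = y" using irr tr unfolding less_eq_levi_civita_def by blast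
  show "x \<le> y \<or> y \<le> x"
  proof (cases "x = y")
    case False
    then have "x - y \<noteq> 0" by simp
    then obtain q where q: "lc_nth (x - y) q \<noteq> 0" "\<And>p. p < q \<Longrightarrow> lc_nth (x - y) p = 0"
      using lc_lambda_obtain by blast
    then consider "lc_nth x q < lc_nth y q" | "lc_nth y q < lc_nth x q" by fastforce
    then have "x < y \<or> y < x" by cases (use q in \<open>force simp: lc_less_iff\<close>)+
    then show ?thesis by (auto simp: less_eq_levi_civita_def)
  qed (simp add: less_eq_levi_civita_def)
  show "x \<le> y \<Longrightarrow> z + x \<le> z + y"
    by (auto simp: less_eq_levi_civita_def lc_less_iff)
  show "\<bar>x\<bar> = (if x < 0 then - x else x)" by (rule abs_levi_civita_def)
  show "sgn x = (if x = 0 then 0 else if 0 < x then 1 else - 1)" by (rule sgn_levi_civita_def)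
  have pos: "0 < x * y" if "0 < x" "0 < y" for x y :: levi_civita
  proof -
    from that obtain q r where
      q: "0 < lc_nth x q" "\<And>p. p < q \<Longrightarrow> lc_nth x p = 0" and
      r: "0 < lc_nth y r" "\<And>p. p < r \<Longrightarrow> lc_nth y p = 0"
      by (auto simp: lc_less_iff)
    have "lc_nth (x * y) (q + r) = lc_nth x q * lc_nth y r"
    proof (subst lc_mult_nth[of "{q}"])
      fix p assume p: "lc_nth x p \<noteq> 0" "lc_nth y (q + r - p) \<noteq> 0"
      then have "\<not> p < q" "\<not> q + r - p < r" using q r by auto
      then show "p \<in> {q}" by auto
    qed auto
    moreover have "lc_nth (x * y) p = 0" if "p < q + r" for p
    proof (subst lc_mult_nth[of "{}"])
      fix s assume s: "lc_nth x s \<noteq> 0" "lc_nth y (p - s) \<noteq> 0"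
      then have "\<not> s < q" "\<not> p - s < r" using q r by auto
      then show "s \<in> {}" using that by auto
    qed auto
    ultimately show ?thesis unfolding lc_less_iff using q r by (intro exI[of _ "q + r"]) auto
  qed
  have "0 < y - x" if "x < y" using that by (auto simp: lc_less_iff)
  moreover have "z * x < z * y" if "0 < z * (y - x)"
    using that by (auto simp: lc_less_iff right_diff_distrib)
  ultimately show "x < y \<Longrightarrow> 0 < z \<Longrightarrow> z * x < z * y" using pos by blast
qed

end


subsection \<open>Field structure\<close>

lemma lc_mult_nth_cong:
  assumes "\<And>p. p < 0 \<Longrightarrow> lc_nth x p = 0" and "\<And>p. p \<le> q \<Longrightarrow> lc_nth y p = lc_nth z p"
  shows "lc_nth (x * y) q = lc_nth (x * z) q"
proof -
  let ?S = "{p. lc_nth x p \<noteq> 0 \<and> lc_nth y (q - p) \<noteq> 0} \<union> {p. lc_nth x p \<noteq> 0 \<and> lc_nth z (q - p) \<noteq> 0}"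
  have fin: "finite ?S" using lc_mult_index_finite by auto
  have "lc_nth x p * lc_nth y (q - p) = lc_nth x p * lc_nth z (q - p)" for p
    using assms(1)[of p] assms(2)[of "q - p"] by (cases "p < 0") auto
  then show ?thesis by (subst (1 2) lc_mult_nth[OF fin]; (intro sum.cong refl)?) blast+
qed

lemma lc_nth_mult_below:
  assumes "\<And>p. p < a \<Longrightarrow> lc_nth x p = 0" "\<And>p. p < b \<Longrightarrow> lc_nth y p = 0" "q < a + b"
  shows "lc_nth (x * y) q = 0"
proof (subst lc_mult_nth[of "{}"])
  fix s assume s: "lc_nth x s \<noteq> 0" "lc_nth y (q - s) \<noteq> 0"
  then have "\<not> s < a" "\<not> q - s < b" using assms by auto
  then show "s \<in> {}" using assms(3) by auto
qed auto

lemma lc_nth_power_below: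
  assumes "\<And>p. p < d \<Longrightarrow> lc_nth z p = 0" "q < of_nat k * d"
  shows "lc_nth (z ^ k) q = 0"
  using assms(2)
proof (induction k arbitrary: q)
  case (Suc k)
  show ?case
    using lc_nth_mult_below[of d z "of_nat k * d" "z ^ k" q] assms(1) Suc by (simp add: algebra_simps)
qed auto

lemma lc_inverse_exists:
  assumes "x \<noteq> (0::levi_civita)" shows "\<exists>y. x * y = 1"
proof -
  obtain l where l: "lc_nth x l \<noteq> 0" "\<And>p. p < l \<Longrightarrow> lc_nth x p = 0"
    using lc_lambda_obtain[OF assms] by blast
  define c where "c = Abs_lc (\<lambda>q. if q = - l then 1 / lc_nth x l else 0)"
  have c: "lc_nth c q = (if q = - l then 1 / lc_nth x l else 0)" for q
    unfolding c_def by (subst Abs_lc_inverse) (auto intro: left_finite_finite)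
  define z where "z = 1 - c * x"
  have cx: "lc_nth (c * x) q = lc_nth x (q + l) / lc_nth x l" for q
    by (subst lc_mult_nth[of "{- l}"]) (auto simp: c split: if_splits)
  have z0: "lc_nth z q = 0" if "q \<le> 0" for q
    unfolding z_def using l that by (cases "q = 0") (auto simp: cx)
  obtain d where d: "d > 0" "\<And>p. p < d \<Longrightarrow> lc_nth z p = 0"
  proof (cases "z = 0")
    case False
    then obtain d where "lc_nth z d \<noteq> 0" "\<And>p. p < d \<Longrightarrow> lc_nth z p = 0"
      using lc_lambda_obtain by blast
    then show ?thesis using that z0 by (metis not_less)
  qed (use that[of 1] in auto)
  define N where "N q = nat \<lceil>q / d\<rceil>" for q
  have N: "q < of_nat k * d" if "k > N q" for k q
  proof -
    have "q / d \<le> of_nat (N q)" unfolding N_def by linarith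
    also have "\<dots> < of_nat k" using that by simp
    finally show ?thesis using d by (simp add: field_simps)
  qed
  define g where "g = Abs_lc (\<lambda>q. \<Sum>k\<le>N q. lc_nth (z ^ k) q)"
  have mono: "N p \<le> N q" if "p \<le> q" for p q
    unfolding N_def using that d by (intro nat_mono ceiling_mono divide_right_mono) auto
  have extend: "(\<Sum>k\<le>N p. lc_nth (z ^ k) p) = (\<Sum>k\<le>M. lc_nth (z ^ k) p)" if "N p \<le> M" for p M
    using that lc_nth_power_below[of d z p] d(2) N[of p]
    by (intro sum.mono_neutral_left) auto
  have "left_finite {q. (\<Sum>k\<le>N q. lc_nth (z ^ k) q) \<noteq> 0}"
    unfolding left_finite_def
  proof
    fix q
    have "{p \<in> {q. (\<Sum>k\<le>N q. lc_nth (z ^ k) q) \<noteq> 0}. p \<le> q}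
        \<subseteq> {p. lc_nth (\<Sum>k\<le>N q. z ^ k) p \<noteq> 0 \<and> p \<le> q}"
      using extend[OF mono] by auto
    then show "finite {p \<in> {q. (\<Sum>k\<le>N q. lc_nth (z ^ k) q) \<noteq> 0}. p \<le> q}"
      using finite_supp_le finite_subset by blast
  qed
  then have g: "lc_nth g q = (\<Sum>k\<le>N q. lc_nth (z ^ k) q)" for q
    unfolding g_def by (simp add: Abs_lc_inverse)
  have "(1 - z) * g = 1"
    unfolding lc_eq_iff
  proof
    fix q
    have "lc_nth ((1 - z) * g) q = lc_nth ((1 - z) * (\<Sum>k\<le>N q. z ^ k)) q"
      using z0 extend[OF mono] by (intro lc_mult_nth_cong) (auto simp: g)
    also have "(1 - z) * (\<Sum>k\<le>N q. z ^ k) = 1 - z ^ Suc (N q)"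
      by (simp add: sum_gp_basic)
    also have "lc_nth \<dots> q = lc_nth 1 q"
      using lc_nth_power_below[of d z q "Suc (N q)"] d(2) N[of q "Suc (N q)"]
      by (simp del: power_Suc)
    finally show "lc_nth ((1 - z) * g) q = lc_nth 1 q" .
  qed
  then have "x * (c * g) = 1" by (simp add: z_def mult_ac)
  then show ?thesis by blast
qed

instantiation levi_civita :: linordered_field
begin

definition inverse_levi_civita :: "levi_civita \<Rightarrow> levi_civita" where
  "inverse x = (if x = (0::levi_civita) then 0 else (THE y. x * y = 1))"

definition divide_levi_civita :: "levi_civita \<Rightarrow> levi_civita \<Rightarrow> levi_civita" where
  "x div y = x * inverse (y::levi_civita)"

instance
proof
  fix a b :: levi_civita
  show "inverse a * a = 1" if a: "a \<noteq> 0"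
  proof -
    obtain y where y: "a * y = 1" using lc_inverse_exists[OF a] by blast
    then have "inverse a = y"
      unfolding inverse_levi_civita_def using a
      by (auto intro!: the_equality) (metis mult_left_cancel)
    then show ?thesis using y by (simp add: mult.commute)
  qed
  show "a div b = a * inverse b" by (rule divide_levi_civita_def)
  show "inverse (0::levi_civita) = 0" by (simp add: inverse_levi_civita_def)
qed

end

instance levi_civita :: real_field ..


section \<open>Convergence\<close>

definition strongly_converges :: "(nat \<Rightarrow> levi_civita) \<Rightarrow> levi_civita \<Rightarrow> bool" where
  "strongly_converges s l \<longleftrightarrow> (\<forall>\<epsilon>>0. \<exists>N. \<forall>n\<ge>N. \<bar>s n - l\<bar> < \<epsilon>)"

definition strongly_sums :: "(nat \<Rightarrow> levi_civita) \<Rightarrow> levi_civita \<Rightarrow> bool" where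
  "strongly_sums s l \<longleftrightarrow> strongly_converges (\<lambda>N. \<Sum>n<N. s n) l"

definition weak_seminorm :: "real \<Rightarrow> levi_civita \<Rightarrow> real" where
  "weak_seminorm \<epsilon> x = (MAX q\<in>{q. of_rat q \<le> inverse \<epsilon>}. \<bar>lc_nth x q\<bar>)"

text \<open>The index set of this maximum is infinite, but left-finiteness of the support makes the set
  of values finite, so the maximum is genuine.\<close>

lemma weak_seminorm_less_iff:
  "weak_seminorm \<epsilon> x < c \<longleftrightarrow> (\<forall>q. of_rat q \<le> inverse \<epsilon> \<longrightarrow> \<bar>lc_nth x q\<bar> < c)"
proof -
  let ?Q = "{q :: rat. (of_rat q :: real) \<le> inverse \<epsilon>}"
  obtain B :: rat where "inverse \<epsilon> < of_rat B"
    using of_rat_dense[of "inverse \<epsilon>" "inverse \<epsilon> + 1"] by auto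
  then have B: "q \<le> B" if "q \<in> ?Q" for q
    using that of_rat_less_eq[of q B, where 'a=real] by (simp del: of_rat_less_eq)
  have "(\<lambda>q. \<bar>lc_nth x q\<bar>) ` ?Q \<subseteq> insert 0 ((\<lambda>q. \<bar>lc_nth x q\<bar>) ` {q. lc_nth x q \<noteq> 0 \<and> q \<le> B})"
    using B by (auto simp: image_iff)
  then have fin: "finite ((\<lambda>q. \<bar>lc_nth x q\<bar>) ` ?Q)"
    using finite_supp_le[of x B] by (meson finite.insertI finite_imageI finite_subset)
  obtain p :: rat where "of_rat p < inverse \<epsilon>"
    using of_rat_dense[of "inverse \<epsilon> - 1" "inverse \<epsilon>"] by auto
  then have "?Q \<noteq> {}" by (auto intro: less_imp_le)
  then show ?thesis unfolding weak_seminorm_def using fin by (subst Max_less_iff) auto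
qed

definition weakly_converges :: "(nat \<Rightarrow> levi_civita) \<Rightarrow> levi_civita \<Rightarrow> bool" where
  "weakly_converges s l \<longleftrightarrow> (\<forall>\<epsilon>>0. \<exists>N. \<forall>n\<ge>N. weak_seminorm \<epsilon> (s n - l) < \<epsilon>)"


section \<open>Measurable sets and measurable functions\<close>

definition interval_between :: "levi_civita \<Rightarrow> levi_civita \<Rightarrow> levi_civita set \<Rightarrow> bool" where
  "interval_between a b I \<longleftrightarrow> a \<le> b \<and> I \<in> {{a..b}, {a..<b}, {a<..b}, {a<..<b}}"

text \<open>\<open>disjoint_intervals I s\<close>: the \<open>I n\<close> are mutually disjoint intervals and the series of their
  lengths converges strongly to \<open>s\<close>. Empty intervals have length 0 and may be repeated, so finite
  families are included.\<close>

definition disjoint_intervals :: "(nat \<Rightarrow> levi_civita set) \<Rightarrow> levi_civita \<Rightarrow> bool" where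
  "disjoint_intervals I s \<longleftrightarrow> disjoint_family I \<and>
     (\<exists>a b. (\<forall>n. interval_between (a n) (b n) (I n)) \<and> strongly_sums (\<lambda>n. b n - a n) s)"

definition lc_measurable :: "levi_civita set \<Rightarrow> bool" where
  "lc_measurable A \<longleftrightarrow> (\<forall>\<epsilon>>0. \<exists>I J s t.
     disjoint_intervals I s \<and> disjoint_intervals J t \<and>
     (\<Union>n. I n) \<subseteq> A \<and> A \<subseteq> (\<Union>n. J n) \<and> t - s \<le> \<epsilon>)"

definition inner_sums :: "levi_civita set \<Rightarrow> levi_civita set" where
  "inner_sums A = {s. \<exists>I. disjoint_intervals I s \<and> (\<Union>n. I n) \<subseteq> A}"

text \<open>The supremum of the inner sums. The order is not complete, so the supremum is
  written as the least upper bound; it exists for measurable \<open>A\<close>.\<close>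

definition lc_measure :: "levi_civita set \<Rightarrow> levi_civita" where
  "lc_measure A = (LEAST m. \<forall>s\<in>inner_sums A. s \<le> m)"

definition simple_on :: "levi_civita set \<Rightarrow> (levi_civita \<Rightarrow> levi_civita) \<Rightarrow> bool" where
  "simple_on I f \<longleftrightarrow> (\<exists>x0 a. \<forall>x\<in>I. weakly_converges (\<lambda>K. \<Sum>k\<le>K. a k * (x - x0) ^ k) (f x))"

text \<open>Functions on \<open>A\<close> are represented by total functions; only the values on \<open>A\<close> matter here.\<close>

definition lc_measurable_funs :: "levi_civita set \<Rightarrow> (levi_civita \<Rightarrow> levi_civita) set" where
  "lc_measurable_funs A = {f. lc_measurable A \<and> (\<forall>\<epsilon>>0. \<exists>I s.
     disjoint_intervals I s \<and> (\<Union>n. I n) \<subseteq> A \<and> lc_measure A - s < \<epsilon> \<and> (\<forall>n. simple_on (I n) f))}"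


section \<open>Real functions and their extensions\<close>

text \<open>Derivatives relative to \<open>S\<close>: for \<open>S = {a..b}\<close> with \<open>a < b\<close> these are unique, and one-sided
  at the endpoints.\<close>

primrec nth_deriv_within :: "real set \<Rightarrow> nat \<Rightarrow> (real \<Rightarrow> real) \<Rightarrow> real \<Rightarrow> real" where
  "nth_deriv_within S 0 f = f"
| "nth_deriv_within S (Suc i) f =
     (\<lambda>x. THE D. (nth_deriv_within S i f has_real_derivative D) (at x within S))"

definition C_n_on :: "nat \<Rightarrow> real set \<Rightarrow> (real \<Rightarrow> real) \<Rightarrow> bool" where
  "C_n_on n S f \<longleftrightarrow>
     (\<forall>i<n. \<forall>x\<in>S. \<exists>D. (nth_deriv_within S i f has_real_derivative D) (at x within S)) \<and>
     continuous_on S (nth_deriv_within S n f)"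

definition locally_analytic_within :: "real set \<Rightarrow> (real \<Rightarrow> real) \<Rightarrow> real \<Rightarrow> bool" where
  "locally_analytic_within S f r \<longleftrightarrow>
     (\<exists>c :: nat \<Rightarrow> real. \<exists>\<delta>>0. \<forall>x\<in>S. \<bar>x - r\<bar> < \<delta> \<longrightarrow> (\<lambda>k. c k * (x - r) ^ k) sums f x)"

text \<open>An element \<open>x\<close> of \<open>{of_real a..of_real b}\<close> is uniquely \<open>r + \<epsilon>\<close> with \<open>r\<close> real and \<open>\<epsilon>\<close>
  infinitesimal, where \<open>r = x[0]\<close>.\<close>

definition order_ext :: "real \<Rightarrow> real \<Rightarrow> nat \<Rightarrow> (real \<Rightarrow> real) \<Rightarrow> levi_civita \<Rightarrow> levi_civita" where
  "order_ext a b n f x =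
     (let r = lc_nth x 0; \<epsilon> = x - of_real r
      in \<Sum>i\<le>n. of_real (nth_deriv_within {a..b} i f r) * (\<epsilon> ^ i / fact i))"

lemma order_ext_eq:
  assumes "infinitesimal \<epsilon>"
  shows "order_ext a b n f (of_real r + \<epsilon>) =
    (\<Sum>i\<le>n. of_real (nth_deriv_within {a..b} i f r) * (\<epsilon> ^ i / fact i))"
  using assms by (simp add: order_ext_def infinitesimal_iff)

lemma standard_decomposition:
  assumes "x \<in> {of_real a..of_real b}"
  shows "lc_nth x 0 \<in> {a..b}" "infinitesimal (x - of_real (lc_nth x 0))"
proof -
  have neg: "lc_nth x q = 0" if "q < 0" for q
  proof (rule ccontr)
    assume "lc_nth x q \<noteq> 0"
    then have "x \<noteq> 0" by auto
    then obtain l where l: "lc_nth x l \<noteq> 0" "\<And>p. p < l \<Longrightarrow> lc_nth x p = 0"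
      using lc_lambda_obtain by blast
    with \<open>lc_nth x q \<noteq> 0\<close> have "l < 0" using that by (meson not_less order.strict_trans1)
    have "x < of_real a" if "lc_nth x l < 0"
      using that l \<open>l < 0\<close> by (auto simp: lc_less_iff intro!: exI[of _ l])
    moreover have "of_real b < x" if "lc_nth x l > 0"
      using that l \<open>l < 0\<close> by (auto simp: lc_less_iff intro!: exI[of _ l])
    ultimately show False using assms l by force
  qed
  have "x < of_real a" if "lc_nth x 0 < a"
    using that neg by (auto simp: lc_less_iff intro!: exI[of _ 0])
  moreover have "of_real b < x" if "lc_nth x 0 > b"
    using that neg by (auto simp: lc_less_iff intro!: exI[of _ 0])
  ultimately show "lc_nth x 0 \<in> {a..b}" using assms by force
  show "infinitesimal (x - of_real (lc_nth x 0))"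
    using neg by (auto simp: infinitesimal_iff order_le_less)
qed

end

theory Submission
  imports Defs "HOL-Analysis.Analysis"
begin

text \<open>
  If the extension were measurable on \<open>A\<close>, it would be simple on an interval \<open>I\<close> of non-infinitesimal
  length, hence on \<open>I\<close> a weak limit of polynomials \<open>P\<^sub>K\<close> over the Levi-Civita field; nothing more about
  the power series is needed, in particular not where its centre lies. Let \<open>d\<close> be the basic
  infinitesimal and consider the points \<open>x = \<Sum>c\<^sub>k d^k\<close> as a Polish space of real sequences. For \<open>x\<close> in \<open>I\<close>
  the coefficients \<open>P\<^sub>K(x)[q]\<close>, \<open>q < 0\<close>, are eventually bounded by 1, so by Baire they are bounded
  uniformly for large \<open>K\<close> on an open box, in which all but finitely many \<open>c\<^sub>s\<close> range over all reals. A
  bounded real polynomial in \<open>c\<^sub>s\<close> is constant; this gives a lower bound, uniform in \<open>K\<close>, for the supports of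
  the derivatives of \<open>P\<^sub>K\<close>. With this bound, the coefficient of \<open>d^(j t)\<close> in \<open>P\<^sub>K(y + \<xi> + c d^t)\<close> has
  degree at most \<open>j\<close> in \<open>c\<close> when \<open>t\<close> is large, with leading coefficient \<open>p\<^sub>K^(j)(y) / j!\<close> for the real
  polynomial \<open>p\<^sub>K(y) = P\<^sub>K(y + \<xi>)[0]\<close>. Its limit has degree at most \<open>n\<close> in \<open>c\<close>, by the definition of the order
  \<open>n\<close> extension. So all derivatives of \<open>p\<^sub>K\<close> converge pointwise, the one of order \<open>n + 1\<close> to 0, and
  \<open>p\<^sub>K\<close> converges to \<open>f\<close>. By Baire once more and dominated convergence, \<open>f\<close> is a polynomial on some interval.
\<close>

section \<open>Powers of the basic infinitesimal and strong convergence\<close>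

text \<open>The power \<open>d^q\<close> of the basic infinitesimal \<open>d = dpow 1\<close>, for
  any rational exponent \<open>q\<close>.\<close>

lift_definition dpow :: "rat \<Rightarrow> levi_civita" is "\<lambda>q p. if p = q then 1 else 0"
  by (simp add: left_finite_finite)

lemma dpow_nth [simp]: "lc_nth (dpow q) p = (if p = q then 1 else 0)"
  by (simp add: dpow.rep_eq)

lemma lc_nth_mult_dpow [simp]: "lc_nth (x * dpow p) q = lc_nth x (q - p)"
  by (subst lc_mult_nth[of "{q - p}"]) (auto split: if_splits)

lemma dpow_add: "dpow (p + q) = dpow p * dpow q"
  by (auto simp: lc_eq_iff)

lemma dpow_0 [simp]: "dpow 0 = 1"
  by (auto simp: lc_eq_iff)

lemma dpow_power: "dpow q ^ k = dpow (of_nat k * q)"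
  by (induction k) (auto simp: dpow_add[symmetric] algebra_simps)

lemma dpow_pos [simp]: "0 < dpow q"
  by (auto simp: lc_less_iff intro!: exI[of _ q])

lemma dpow_nonneg [simp]: "0 \<le> dpow q"
  by (simp add: less_imp_le)

lemma lc_pos_iff: "0 < x \<longleftrightarrow> (\<exists>q. 0 < lc_nth x q \<and> (\<forall>p<q. lc_nth x p = 0))"
  by (auto simp: lc_less_iff)

text \<open>Any integer beyond the leading exponent of \<open>\<epsilon>\<close> will do. Countably
  many tolerances thus suffice for strong limits.\<close>

lemma dpow_less_pos:
  assumes "0 < \<epsilon>" shows "\<exists>N::nat. \<forall>n\<ge>N. dpow (of_nat n) < \<epsilon>"
proof -
  obtain q where q: "0 < lc_nth \<epsilon> q" "\<And>p. p < q \<Longrightarrow> lc_nth \<epsilon> p = 0"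
    using assms by (auto simp: lc_pos_iff)
  obtain N :: nat where N: "q < of_nat N" using reals_Archimedean2 by blast
  have "dpow (of_nat n) < \<epsilon>" if "n \<ge> N" for n
  proof -
    have "q < of_nat n" using N that by (meson less_le_trans of_nat_mono)
    then show ?thesis using q by (auto simp: lc_less_iff intro!: exI[of _ q])
  qed
  then show ?thesis by blast
qed

lemma abs_less_dpowI:
  assumes "\<And>p. p \<le> q \<Longrightarrow> lc_nth x p = 0" shows "\<bar>x\<bar> < dpow q"
proof -
  have "y < dpow q" if "\<And>p. p \<le> q \<Longrightarrow> lc_nth y p = 0" for y
    using that by (auto simp: lc_less_iff intro!: exI[of _ q])
  from this[of x] this[of "- x"] show ?thesis using assms by (auto simp: abs_if)
qed

text \<open>A leading exponent of \<open>x\<close> below \<open>q\<close> would make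
  \<open>\<bar>x\<bar>\<close> exceed \<open>dpow q\<close>. The coefficient at \<open>q\<close>
  itself is not controlled.\<close>

lemma abs_less_dpowD:
  assumes "\<bar>x\<bar> < dpow q" "p < q" shows "lc_nth x p = 0"
proof (rule ccontr)
  assume p: "lc_nth x p \<noteq> 0"
  then have "x \<noteq> 0" by auto
  then obtain l where l: "lc_nth x l \<noteq> 0" "\<And>p. p < l \<Longrightarrow> lc_nth x p = 0"
    using lc_lambda_obtain by blast
  have "l < q" using p l(2)[of p] assms(2) by force
  have "lc_nth \<bar>x\<bar> l \<noteq> 0" "\<And>p. p < l \<Longrightarrow> lc_nth \<bar>x\<bar> p = 0" using l by (auto simp: abs_if)
  moreover have "0 \<le> \<bar>x\<bar>" by simp
  ultimately have "0 < lc_nth \<bar>x\<bar> l"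
    by (metis abs_not_less_zero lc_less_iff linorder_neqE_linordered_idom zero_levi_civita.rep_eq)
  then have "dpow q < \<bar>x\<bar>" using \<open>l < q\<close> \<open>\<And>p. p < l \<Longrightarrow> lc_nth \<bar>x\<bar> p = 0\<close>
    by (auto simp: lc_less_iff intro!: exI[of _ l])
  then show False using assms(1) by simp
qed

lemma infinitesimal_add: "infinitesimal x \<Longrightarrow> infinitesimal y \<Longrightarrow> infinitesimal (x + y)"
  by (simp add: infinitesimal_iff)

lemma infinitesimal_mult:
  assumes "infinitesimal x" "infinitesimal y" shows "infinitesimal (x * y)"
  unfolding infinitesimal_iff
proof (intro allI impI)
  fix q :: rat assume "q \<le> 0"
  show "lc_nth (x * y) q = 0"
  proof (subst lc_mult_nth[of "{}"])
    fix p assume p: "lc_nth x p \<noteq> 0" "lc_nth y (q - p) \<noteq> 0"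
    have "0 < p" "0 < q - p"
      using assms p unfolding infinitesimal_iff by (meson not_le)+
    then show "p \<in> {}" using \<open>q \<le> 0\<close> by auto
  qed auto
qed

lemma infinitesimal_sum: "(\<And>i. i \<in> A \<Longrightarrow> infinitesimal (g i)) \<Longrightarrow> infinitesimal (sum g A)"
  by (simp add: infinitesimal_iff)

lemma infinitesimal_abs_le:
  assumes "infinitesimal y" "\<bar>x\<bar> \<le> y" shows "infinitesimal x"
proof -
  have "infinitesimal z" if z: "0 \<le> z" "z \<le> y" for z
  proof (cases "z = 0")
    case False
    then have "0 < z" using z by simp
    then obtain q where q: "0 < lc_nth z q" "\<forall>p<q. lc_nth z p = 0" by (auto simp: lc_pos_iff)
    have "q > 0"
    proof (rule ccontr)
      assume "\<not> 0 < q"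
      then have "y < z"
        using q assms(1) by (auto simp: lc_less_iff infinitesimal_iff intro!: exI[of _ q])
      then show False using z by simp
    qed
    then show ?thesis using q by (auto simp: infinitesimal_iff)
  qed (simp add: infinitesimal_iff)
  from this[of "\<bar>x\<bar>"] assms(2) have "infinitesimal \<bar>x\<bar>" by simp
  then show ?thesis by (auto simp: infinitesimal_iff abs_if split: if_splits)
qed

lemma infinitesimal_dpow: "0 < q \<Longrightarrow> infinitesimal (dpow q)"
  by (auto simp: infinitesimal_iff)

text \<open>In a strongly Cauchy sequence all coefficients with exponent at most \<open>q\<close>
  are eventually constant. The limit collects these eventual values, and its support is left-finite
  because below each \<open>q\<close> it agrees with a single member of the sequence.\<close>

lemma strongly_Cauchy_converges:
  assumes "\<And>\<epsilon>. \<epsilon> > 0 \<Longrightarrow> \<exists>N. \<forall>m\<ge>N. \<forall>n\<ge>N. \<bar>s m - s n\<bar> < \<epsilon>"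
  obtains l where "strongly_converges s l"
proof -
  have "\<exists>N. \<forall>m\<ge>N. \<forall>p\<le>q. lc_nth (s m) p = lc_nth (s N) p" for q
  proof -
    obtain N where N: "\<And>m n. m \<ge> N \<Longrightarrow> n \<ge> N \<Longrightarrow> \<bar>s m - s n\<bar> < dpow (q + 1)"
      \<comment> \<open>The tolerance \<open>dpow (q + 1)\<close> is used because a bound by
        \<open>dpow q\<close> says nothing about the coefficient at \<open>q\<close>.\<close>
      using assms[OF dpow_pos] by metis
    have "lc_nth (s m) p = lc_nth (s N) p" if "m \<ge> N" "p \<le> q" for m p
      using abs_less_dpowD[OF N[of m N], of p] that by simp
    then show ?thesis by blast
  qed
  then obtain N where N: "\<And>q m p. m \<ge> N q \<Longrightarrow> p \<le> q \<Longrightarrow> lc_nth (s m) p = lc_nth (s (N q)) p"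
    by metis
  define l where "l = Abs_lc (\<lambda>q. lc_nth (s (N q)) q)"
  have eq: "lc_nth (s (N p)) p = lc_nth (s m) p" if "m \<ge> N q" "p \<le> q" for p q m
    using N[where q=q and m="max m (N p)" and p=p] N[where q=p and m="max m (N p)" and p=p]
      N[where q=q and m=m and p=p] that by simp
  have "left_finite {q. lc_nth (s (N q)) q \<noteq> 0}"
    unfolding left_finite_def
  proof
    fix q
    have "{x \<in> {q. lc_nth (s (N q)) q \<noteq> 0}. x \<le> q} \<subseteq> {p. lc_nth (s (N q)) p \<noteq> 0 \<and> p \<le> q}"
      using eq[OF order_refl] by auto
    then show "finite {x \<in> {q. lc_nth (s (N q)) q \<noteq> 0}. x \<le> q}"
      using finite_supp_le finite_subset by blast
  qed
  then have l: "lc_nth l q = lc_nth (s (N q)) q" for q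
    unfolding l_def by (simp add: Abs_lc_inverse)
  have "strongly_converges s l"
    unfolding strongly_converges_def
  proof (intro allI impI)
    fix \<epsilon> :: levi_civita assume "\<epsilon> > 0"
    then obtain k :: nat where k: "dpow (of_nat k) < \<epsilon>" using dpow_less_pos by blast
    have "\<bar>s m - l\<bar> < \<epsilon>" if "m \<ge> N (of_nat k)" for m
    proof -
      have "\<bar>s m - l\<bar> < dpow (of_nat k)"
        using that eq by (intro abs_less_dpowI) (auto simp: l)
      then show ?thesis using k by simp
    qed
    then show "\<exists>N. \<forall>n\<ge>N. \<bar>s n - l\<bar> < \<epsilon>" by blast
  qed
  then show ?thesis using that by blast
qed

lemma strong_limit_le:
  assumes "strongly_converges s l" "\<And>n. n \<ge> N \<Longrightarrow> s n \<le> u" shows "l \<le> u"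
proof (rule ccontr)
  assume "\<not> l \<le> u"
  then obtain M where "\<And>n. n \<ge> M \<Longrightarrow> \<bar>s n - l\<bar> < l - u"
    using assms(1) unfolding strongly_converges_def by (metis diff_gt_0_iff_gt not_le)
  from this[of "max N M"] assms(2)[of "max N M"] show False by (simp add: abs_if split: if_splits)
qed

lemma strong_limit_ge:
  assumes "strongly_converges s l" "\<And>n. n \<ge> N \<Longrightarrow> u \<le> s n" shows "u \<le> l"
proof (rule ccontr)
  assume "\<not> u \<le> l"
  then obtain M where "\<And>n. n \<ge> M \<Longrightarrow> \<bar>s n - l\<bar> < u - l"
    using assms(1) unfolding strongly_converges_def by (metis diff_gt_0_iff_gt not_le)
  from this[of "max N M"] assms(2)[of "max N M"] show False by (simp add: abs_if split: if_splits)
qed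

lemma strongly_sums_partial_le:
  assumes "strongly_sums g s" "\<And>n. 0 \<le> g n" shows "(\<Sum>n<N. g n) \<le> s"
proof (rule strong_limit_ge)
  show "strongly_converges (\<lambda>N. \<Sum>n<N. g n) s" using assms(1) by (simp add: strongly_sums_def)
  show "(\<Sum>n<N. g n) \<le> (\<Sum>n<M. g n)" if "N \<le> M" for M
    using that assms(2) by (intro sum_mono2) auto
qed

lemma strongly_sums_tail:
  assumes "strongly_sums g s" "0 < \<epsilon>"
  shows "\<exists>M. \<forall>N\<ge>M. \<forall>K\<ge>N. (\<Sum>n=N..<K. g n) < \<epsilon>"
proof -
  have "\<epsilon> / 2 > 0" using assms by simp
  then obtain M where M: "\<And>n. n \<ge> M \<Longrightarrow> \<bar>(\<Sum>k<n. g k) - s\<bar> < \<epsilon> / 2"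
    using assms(1) unfolding strongly_sums_def strongly_converges_def by metis
  have "(\<Sum>n=N..<K. g n) < \<epsilon>" if "N \<ge> M" "K \<ge> N" for N K
  proof -
    have "(\<Sum>n=N..<K. g n) = (\<Sum>k<K. g k) - (\<Sum>k<N. g k)"
      using that by (simp add: sum_diff_nat_ivl[of 0 N K g, simplified atLeast0LessThan])
    then show ?thesis using M[of N] M[of K] that by (simp add: abs_if field_simps split: if_splits)
  qed
  then show ?thesis by blast
qed


section \<open>Covers by intervals\<close>

text \<open>The length of the intersection of the intervals from \<open>c\<close> to
  \<open>e\<close> and from \<open>p\<close> to \<open>q\<close>, with 0 when they do not
  meet.\<close>

definition overlap :: "'a::linordered_field \<Rightarrow> 'a \<Rightarrow> 'a \<Rightarrow> 'a \<Rightarrow> 'a" where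
  "overlap c e p q = max 0 (min e q - max c p)"

lemma overlap_nonneg [simp]: "0 \<le> overlap c e p q"
  by (simp add: overlap_def)

lemma overlap_le: "p \<le> q \<Longrightarrow> overlap c e p q \<le> q - p"
  by (auto simp: overlap_def max_def min_def)

text \<open>The map taking \<open>x\<close> to \<open>max c (min e x)\<close> projects onto
  \<open>{c..e}\<close>. Writing the overlap as a difference of projected endpoints makes it
  additive in \<open>{c..e}\<close>.\<close>

lemma overlap_cut:
  assumes "c \<le> e" "p \<le> q"
  shows "overlap c e p q = max c (min e q) - max c (min e p)"
proof (cases "e \<le> p \<or> q \<le> c")
  case True
  then show ?thesis using assms by (auto simp: overlap_def max_def min_def)
next
  case False
  then have "c \<le> min e q" "max c (min e p) = max c p" "max c p \<le> min e q"
    using assms by (auto simp: min_absorb2)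
  then show ?thesis by (simp add: overlap_def max_absorb2)
qed

text \<open>Cutting at \<open>u\<close> is exact, since the two projections add up to the projection
  onto \<open>{c..e}\<close> plus the constant \<open>u\<close>. Moving the left end from
  \<open>u\<close> to \<open>v\<close> can only lose overlap.\<close>

lemma overlap_split:
  assumes "c \<le> u" "u \<le> v" "v \<le> e" "p \<le> q"
  shows "overlap c u p q + overlap v e p q \<le> overlap c e p q"
proof -
  have *: "max c (min u x) + max u (min e x) = max c (min e x) + u" for x
    using assms by (cases "x \<le> u") (auto simp: min_absorb1 min_absorb2 max_absorb1 max_absorb2)
  have "overlap c u p q + overlap u e p q = overlap c e p q"
    using *[of p] *[of q] assms by (simp add: overlap_cut)
  moreover have "overlap v e p q \<le> overlap u e p q"
    using assms(2) unfolding overlap_def by (intro max.mono diff_mono) auto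
  ultimately show ?thesis by linarith
qed

text \<open>Induction by largest right endpoint: the interval \<open>x\<close> ending last has all
  others to its left, so the induction hypothesis applies with \<open>c x\<close> in place of
  \<open>q\<close>.\<close>

lemma disjoint_lengths_le:
  fixes c e :: "'i \<Rightarrow> 'a::linordered_field"
  assumes "finite F" "p \<le> q"
    and "\<And>i. i \<in> F \<Longrightarrow> c i < e i" "\<And>i. i \<in> F \<Longrightarrow> p \<le> c i" "\<And>i. i \<in> F \<Longrightarrow> e i \<le> q"
    and "\<And>i j. i \<in> F \<Longrightarrow> j \<in> F \<Longrightarrow> i \<noteq> j \<Longrightarrow> e i \<le> c j \<or> e j \<le> c i"
  shows "(\<Sum>i\<in>F. e i - c i) \<le> q - p"
  using assms
proof (induction F arbitrary: q rule: finite_ranking_induct[where f = e])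
  case (insert x S)
  show ?case
  proof (cases "x \<in> S")
    case False
    have "e i \<le> c x" if "i \<in> S" for i
    proof -
      have "e i \<le> c x \<or> e x \<le> c i" using insert.prems(5)[of i x] that False by auto
      moreover have "e i \<le> e x" "c i < e i" using insert that by auto
      ultimately show ?thesis by auto
    qed
    then have "(\<Sum>i\<in>S. e i - c i) \<le> c x - p" using insert.prems by (intro insert.IH) auto
    moreover have "e x \<le> q" using insert.prems by auto
    ultimately show ?thesis using False insert.hyps by (simp add: algebra_simps)
  qed (use insert in \<open>simp add: insert_absorb\<close>)
qed auto

lemma sum_overlap_le:
  fixes c e :: "'i \<Rightarrow> 'a::linordered_field"
  assumes "finite F" "p \<le> q"
    and dis: "\<And>i j. i \<in> F \<Longrightarrow> j \<in> F \<Longrightarrow> i \<noteq> j \<Longrightarrow> {c i<..<e i} \<inter> {c j<..<e j} = {}"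
  shows "(\<Sum>i\<in>F. overlap (c i) (e i) p q) \<le> q - p"
proof -
  let ?G = "{i \<in> F. max (c i) p < min (e i) q}"
  \<comment> \<open>Empty overlaps are dropped because \<open>disjoint_lengths_le\<close> needs
    nondegenerate intervals.\<close>
  have "(\<Sum>i\<in>F. overlap (c i) (e i) p q) = (\<Sum>i\<in>?G. min (e i) q - max (c i) p)"
    using assms(1) by (intro sum.mono_neutral_cong_right) (auto simp: overlap_def max_def)
  also have "\<dots> \<le> q - p"
  proof (rule disjoint_lengths_le)
    fix i j assume ij: "i \<in> ?G" "j \<in> ?G" "i \<noteq> j"
    show "min (e i) q \<le> max (c j) p \<or> min (e j) q \<le> max (c i) p"
    proof (rule ccontr)
      assume "\<not> ?thesis"
      then have "max (max (c i) p) (max (c j) p) < min (min (e i) q) (min (e j) q)"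
        using ij by auto
      then obtain x where "max (max (c i) p) (max (c j) p) < x" "x < min (min (e i) q) (min (e j) q)"
        using dense by blast
      then have "x \<in> {c i<..<e i} \<inter> {c j<..<e j}" by auto
      then show False using dis ij by blast
    qed
  qed (use assms in auto)
  finally show ?thesis .
qed

lemma half_slack_cases:
  fixes \<delta> :: "'a::linordered_field"
  assumes "g + h + \<delta> \<le> x + y" shows "g + \<delta> / 2 \<le> x \<or> h + \<delta> / 2 \<le> y"
  using assms field_sum_of_halves[of \<delta>] by linarith

text \<open>Cutting one covering interval out of \<open>{c..e}\<close> leaves a left and a right
  piece. The slack \<open>\<delta>\<close> is shared between them, so one piece keeps at least half
  of it; after \<open>K\<close> cuts at least \<open>\<delta> / 2 ^ K\<close> remains.\<close>

lemma exists_gap: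
  fixes c e :: "'a::linordered_field"
  assumes "\<And>k. p k \<le> q k" "0 < \<delta>" "(\<Sum>k=M..<M+K. overlap c e (p k) (q k)) + \<delta> \<le> e - c"
  shows "\<exists>c' e'. c \<le> c' \<and> c' < e' \<and> e' \<le> e \<and> \<delta> / 2 ^ K \<le> e' - c' \<and>
           (\<forall>k\<in>{M..<M+K}. e' \<le> p k \<or> q k \<le> c')"
  using assms(2,3)
proof (induction K arbitrary: c e M \<delta>)
  case 0
  then show ?case by (intro exI[of _ c] exI[of _ e]) auto
next
  case (Suc K)
  \<comment> \<open>The endpoints of the first covering interval, projected onto
    \<open>{c..e}\<close>.\<close>
  let ?u = "max c (min e (p M))" and ?v = "max c (min e (q M))"
  let ?f = "\<lambda>k. overlap c e (p k) (q k)"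
  let ?g = "\<lambda>k. overlap c ?u (p k) (q k)"
  let ?h = "\<lambda>k. overlap ?v e (p k) (q k)"
  have "0 \<le> sum ?f {M..<M + Suc K}" by (simp add: sum_nonneg)
  then have "c \<le> e" using Suc.prems by linarith
  then have uv: "c \<le> ?u" "?u \<le> ?v" "?v \<le> e" using assms(1)[of M]
    by (auto intro: max.mono min.mono max.coboundedI2 min.coboundedI2)
  have "(\<Sum>k=M..<M+Suc K. ?f k) = ?f M + (\<Sum>k=Suc M..<Suc M+K. ?f k)"
    by (simp add: sum.atLeast_Suc_lessThan)
  moreover have "(\<Sum>k=Suc M..<Suc M+K. ?g k) + (\<Sum>k=Suc M..<Suc M+K. ?h k) \<le> (\<Sum>k=Suc M..<Suc M+K. ?f k)"
    unfolding sum.distrib[symmetric] using uv assms(1) by (intro sum_mono overlap_split) auto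
  moreover have "?f M = ?v - ?u" using overlap_cut \<open>c \<le> e\<close> assms(1) by blast
  ultimately have "(\<Sum>k=Suc M..<Suc M+K. ?g k) + (\<Sum>k=Suc M..<Suc M+K. ?h k) + \<delta> \<le> (?u - c) + (e - ?v)"
    using Suc.prems(2) by linarith
  then have "(\<Sum>k=Suc M..<Suc M+K. ?g k) + \<delta> / 2 \<le> ?u - c \<or>
      (\<Sum>k=Suc M..<Suc M+K. ?h k) + \<delta> / 2 \<le> e - ?v"
    by (rule half_slack_cases)
  then show ?case
  proof
    assume *: "(\<Sum>k=Suc M..<Suc M+K. ?g k) + \<delta> / 2 \<le> ?u - c"
    obtain c' e' where g: "c \<le> c'" "c' < e'" "e' \<le> ?u" "\<delta> / 2 / 2 ^ K \<le> e' - c'"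
      "\<forall>k\<in>{Suc M..<Suc M+K}. e' \<le> p k \<or> q k \<le> c'"
      using Suc.IH[OF _ *] Suc.prems(1) by auto
    \<comment> \<open>A nondegenerate gap below \<open>?u\<close> excludes \<open>?u = c\<close>, so
      \<open>?u\<close> is at most \<open>p M\<close>.\<close>
    have "e' \<le> p M" using g(1-3) by (auto simp: max_def split: if_splits)
    then have "\<forall>k\<in>{M..<M+Suc K}. e' \<le> p k \<or> q k \<le> c'"
      using g(5) by (metis Suc_leI add_Suc_right add_Suc atLeastLessThan_iff le_neq_implies_less)
    moreover have "e' \<le> e" using g uv by linarith
    ultimately show ?thesis using g by (intro exI[of _ c'] exI[of _ e']) (auto simp: field_simps)
  next
    assume *: "(\<Sum>k=Suc M..<Suc M+K. ?h k) + \<delta> / 2 \<le> e - ?v"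
    obtain c' e' where g: "?v \<le> c'" "c' < e'" "e' \<le> e" "\<delta> / 2 / 2 ^ K \<le> e' - c'"
      "\<forall>k\<in>{Suc M..<Suc M+K}. e' \<le> p k \<or> q k \<le> c'"
      using Suc.IH[OF _ *] Suc.prems(1) by auto
    have "q M \<le> c'" using g(1-3) by (auto simp: min_def split: if_splits)
    then have "\<forall>k\<in>{M..<M+Suc K}. e' \<le> p k \<or> q k \<le> c'"
      using g(5) by (metis Suc_leI add_Suc_right add_Suc atLeastLessThan_iff le_neq_implies_less)
    moreover have "c \<le> c'" using g uv by linarith
    ultimately show ?thesis using g by (intro exI[of _ c'] exI[of _ e']) (auto simp: field_simps)
  qed
qed

text \<open>However many halvings \<open>exists_gap\<close> needs, the lost factor is real and still
  dominates an infinitesimal.\<close>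

lemma dpow_less_inverse_power2: "dpow 1 < 1 / 2 ^ K"
proof -
  have "(1 / 2 ^ K :: levi_civita) = of_real (1 / 2 ^ K)" by simp
  then show ?thesis by (auto simp: lc_less_iff simp del: of_real_divide intro!: exI[of _ 0])
qed

text \<open>
  Nested intervals need not have a common point in this field unless their lengths tend strongly to 0.
  So the new gap is shortened by a factor \<open>dpow 1\<close>, which is affordable because the remaining tail of the
  cover is smaller still.
\<close>

lemma shrink_gap:
  fixes p q :: "nat \<Rightarrow> levi_civita"
  assumes pq: "\<And>k. p k \<le> q k"
    and tail: "\<And>\<epsilon>. 0 < \<epsilon> \<Longrightarrow> \<exists>M. \<forall>N\<ge>M. \<forall>K\<ge>N. (\<Sum>k=N..<K. q k - p k) < \<epsilon>"
    and "0 < \<delta>"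
    and inv: "\<And>K. (\<Sum>k=M..<M+K. overlap c e (p k) (q k)) + \<delta> \<le> e - c"
  shows "\<exists>c' e' M'. c < c' \<and> c' < e' \<and> e' < e \<and> M < M' \<and> e' - c' = dpow 1 * \<delta> \<and>
           (\<forall>k\<in>{M..<M'}. e' < p k \<or> q k < c') \<and>
           (\<forall>K. (\<Sum>k=M'..<M'+K. overlap c' e' (p k) (q k)) + dpow 1 * \<delta> / 2 \<le> e' - c')"
proof -
  \<comment> \<open>The radius of the new interval about the midpoint \<open>m\<close> of the gap.
    The remaining tail of the cover is below \<open>?\<eta>\<close>, which leaves the other half of
    the length as new slack.\<close>
  let ?\<eta> = "dpow 1 * \<delta> / 2"
  have \<eta>: "0 < ?\<eta>" using assms(3) by simp
  obtain M1 where M1: "\<And>N K. N \<ge> M1 \<Longrightarrow> K \<ge> N \<Longrightarrow> (\<Sum>k=N..<K. q k - p k) < ?\<eta>"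
    using tail[OF \<eta>] by blast
  define M' where "M' = max (Suc M) M1"
  define K where "K = M' - M"
  have M': "M < M'" "M1 \<le> M'" "M' = M + K" by (auto simp: M'_def K_def)
  obtain c0 e0 where g: "c \<le> c0" "c0 < e0" "e0 \<le> e" "\<delta> / 2 ^ K \<le> e0 - c0"
     "\<forall>k\<in>{M..<M+K}. e0 \<le> p k \<or> q k \<le> c0"
    using exists_gap[OF pq assms(3) inv] by metis
  define m where "m = (c0 + e0) / 2"
  have "dpow 1 * \<delta> < 1 / 2 ^ K * \<delta>"
    using assms(3) dpow_less_inverse_power2 by (intro mult_strict_right_mono) auto
  then have "2 * ?\<eta> < e0 - c0" using g(4) by simp
  moreover have "2 * m = c0 + e0" by (simp add: m_def)
  ultimately have lt: "c0 < m - ?\<eta>" "m + ?\<eta> < e0" by linarith+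
  have "(\<Sum>k=M'..<M'+N. overlap (m - ?\<eta>) (m + ?\<eta>) (p k) (q k)) \<le> ?\<eta>" for N
  proof -
    have "(\<Sum>k=M'..<M'+N. overlap (m - ?\<eta>) (m + ?\<eta>) (p k) (q k)) \<le> (\<Sum>k=M'..<M'+N. q k - p k)"
      using pq by (intro sum_mono overlap_le) auto
    also have "\<dots> < ?\<eta>" using M1 M' by auto
    finally show ?thesis by simp
  qed
  moreover have "m + ?\<eta> - (m - ?\<eta>) = ?\<eta> + ?\<eta>" by simp
  ultimately have "\<forall>N. (\<Sum>k=M'..<M'+N. overlap (m - ?\<eta>) (m + ?\<eta>) (p k) (q k)) + ?\<eta> \<le> m + ?\<eta> - (m - ?\<eta>)"
    by (metis add_right_mono)
  moreover have "\<forall>k\<in>{M..<M'}. m + ?\<eta> < p k \<or> q k < m - ?\<eta>"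
    using g(5) lt M'(3) by (metis le_less_trans less_le_trans)
  ultimately show ?thesis
    using lt g(1,3) \<eta> M'(1)
    by (intro exI[of _ "m - ?\<eta>"] exI[of _ "m + ?\<eta>"] exI[of _ M']) auto
qed

text \<open>Iterating \<open>shrink_gap\<close> gives nested intervals whose lengths tend strongly
  to 0, the \<open>n\<close>-th one avoiding all covering intervals with index below
  \<open>M n\<close>. The strong limit of the left endpoints lies in all of them.\<close>

lemma uncovered_point:
  fixes p q :: "nat \<Rightarrow> levi_civita"
  assumes pq: "\<And>k. p k \<le> q k"
    and tail: "\<And>\<epsilon>. 0 < \<epsilon> \<Longrightarrow> \<exists>M. \<forall>N\<ge>M. \<forall>K\<ge>N. (\<Sum>k=N..<K. q k - p k) < \<epsilon>"
    and "0 < \<delta>"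
    and inv: "\<And>K. (\<Sum>k<K. overlap c e (p k) (q k)) + \<delta> \<le> e - c"
  obtains x where "c < x" "x < e" "\<And>k. x \<notin> {p k..q k}"
proof -
  \<comment> \<open>\<open>D n\<close> is the slack available at stage \<open>n\<close>; each use of
    \<open>shrink_gap\<close> multiplies it by \<open>dpow 1 / 2\<close>.\<close>
  define D where "D n = \<delta> * (dpow 1 / 2) ^ n" for n
  have D: "0 < D n" "D (Suc n) = dpow 1 * D n / 2" for n
    using assms(3) by (auto simp: D_def)
  \<comment> \<open>\<open>P\<close> is the invariant of a stage, with the start fixed at
    \<open>(c, e, 0)\<close>, and \<open>Q\<close> relates consecutive stages.\<close>
  define P where "P n s \<longleftrightarrow> (case s of (c', e', M) \<Rightarrow>
      \<forall>K. (\<Sum>k=M..<M+K. overlap c' e' (p k) (q k)) + D n \<le> e' - c') \<and> (n = 0 \<longrightarrow> s = (c, e, 0))"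
    for n :: nat and s :: "levi_civita \<times> levi_civita \<times> nat"
  define Q where "Q n s t \<longleftrightarrow> (case s of (c1, e1, M) \<Rightarrow> case t of (c2, e2, M') \<Rightarrow>
      c1 < c2 \<and> c2 < e2 \<and> e2 < e1 \<and> M < M' \<and> e2 - c2 = dpow 1 * D n \<and>
      (\<forall>k\<in>{M..<M'}. e2 < p k \<or> q k < c2))"
    for n :: nat and s t :: "levi_civita \<times> levi_civita \<times> nat"
  have "\<exists>f. \<forall>n. P n (f n) \<and> Q n (f n) (f (Suc n))"
  proof (rule dependent_nat_choice)
    show "\<exists>s. P 0 s"
      using inv by (intro exI[of _ "(c, e, 0)"]) (auto simp: P_def D_def atLeast0LessThan)
  next
    fix s n assume "P n s"
    moreover obtain c1 e1 M where s: "s = (c1, e1, M)" by (cases s)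
    ultimately have "(\<Sum>k=M..<M+K. overlap c1 e1 (p k) (q k)) + D n \<le> e1 - c1" for K
      by (auto simp: P_def)
    from shrink_gap[OF pq tail D(1) this] obtain c2 e2 M' where
      "c1 < c2" "c2 < e2" "e2 < e1" "M < M'" "e2 - c2 = dpow 1 * D n"
      "\<forall>k\<in>{M..<M'}. e2 < p k \<or> q k < c2"
      "\<forall>K. (\<Sum>k=M'..<M'+K. overlap c2 e2 (p k) (q k)) + dpow 1 * D n / 2 \<le> e2 - c2"
      by blast
    then show "\<exists>t. P (Suc n) t \<and> Q n s t"
      by (intro exI[of _ "(c2, e2, M')"]) (simp add: s P_def Q_def D(2))
  qed
  then obtain f where f: "\<And>n. P n (f n)" "\<And>n. Q n (f n) (f (Suc n))" by blast
  define C E M where "C n = fst (f n)" and "E n = fst (snd (f n))" and "M n = snd (snd (f n))" for n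
  have step: "C n < C (Suc n)" "C (Suc n) < E (Suc n)" "E (Suc n) < E n" "M n < M (Suc n)"
    "E (Suc n) - C (Suc n) = dpow 1 * D n" "\<forall>k\<in>{M n..<M (Suc n)}. E (Suc n) < p k \<or> q k < C (Suc n)" for n
    using f(2)[of n] by (auto simp: Q_def C_def E_def M_def split: prod.splits)
  have C0: "C 0 = c" "E 0 = e" "M 0 = 0"
    using f(1)[of 0] by (auto simp: P_def C_def E_def M_def)
  have C_mono: "C m \<le> C n" and E_mono: "E n \<le> E m" if "m \<le> n" for m n
    using that step(1,3) by (auto intro: lift_Suc_mono_le lift_Suc_antimono_le less_imp_le)
  have CE: "C m < E n" if "0 < n" for m n
  proof -
    have "C (max m n) < E (max m n)" using step(2)[of "max m n - 1"] that by simp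
    then show ?thesis using C_mono[of m "max m n"] E_mono[of n "max m n"] by simp
  qed
  have M_ge: "n \<le> M n" for n
    by (induction n) (use step(4) in \<open>auto intro: Suc_leI le_less_trans\<close>)
  have small: "\<exists>n. E (Suc n) - C (Suc n) < \<epsilon>" if "0 < \<epsilon>" for \<epsilon>
  proof -
    have "0 < \<epsilon> / \<delta>" using that assms(3) by simp
    then obtain n :: nat where n: "dpow (of_nat (Suc n)) < \<epsilon> / \<delta>"
      using dpow_less_pos by (metis le_Suc_eq order_refl)
    have "(dpow 1 / 2) ^ n \<le> dpow 1 ^ n" by (intro power_mono) auto
    then have "dpow 1 * D n \<le> dpow 1 * (\<delta> * dpow 1 ^ n)"
      unfolding D_def using assms(3) by (intro mult_left_mono) auto
    also have "\<dots> = dpow (of_nat (Suc n)) * \<delta>"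
      using dpow_power[of 1 "Suc n"] by (simp add: mult_ac)
    also have "\<dots> < \<epsilon>" using n assms(3) by (simp add: pos_less_divide_eq)
    finally show ?thesis using step(5) by metis
  qed
  obtain x where x: "strongly_converges C x"
  proof (rule strongly_Cauchy_converges[of C])
    fix \<epsilon> :: levi_civita assume "0 < \<epsilon>"
    then obtain N where N: "E (Suc N) - C (Suc N) < \<epsilon>" using small by blast
    have "\<bar>C m - C n\<bar> < \<epsilon>" if "m \<ge> Suc N" "n \<ge> Suc N" for m n
      using N C_mono[OF that(1)] C_mono[OF that(2)] CE[of "Suc N" m] CE[of "Suc N" n]
      by (auto simp: abs_if)
    then show "\<exists>N. \<forall>m\<ge>N. \<forall>n\<ge>N. \<bar>C m - C n\<bar> < \<epsilon>" by blast
  qed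
  have lo: "C n \<le> x" for n by (rule strong_limit_ge[OF x, of n]) (rule C_mono)
  have hi: "x \<le> E n" if "0 < n" for n
    by (rule strong_limit_le[OF x, of 0]) (use CE[OF that] in \<open>auto intro: less_imp_le\<close>)
  show ?thesis
  proof
    show "c < x" using step(1)[of 0] lo[of 1] C0 by simp
    show "x < e" using step(3)[of 0] hi[of 1] C0 by simp
    fix k
    have "\<exists>n. k \<in> {M n..<M (Suc n)}"
    proof -
      define n where "n = (LEAST n. k < M (Suc n))"
      have "k < M (Suc k)" using M_ge[of "Suc k"] by simp
      then have 1: "k < M (Suc n)" unfolding n_def by (rule LeastI)
      have "M n \<le> k"
      proof (cases n)
        case (Suc j)
        then have "\<not> k < M (Suc j)" using not_less_Least[of j "\<lambda>n. k < M (Suc n)"] n_def by simp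
        then show ?thesis using Suc by simp
      qed (use C0 in simp)
      then show ?thesis using 1 by auto
    qed
    then obtain n where "E (Suc n) < p k \<or> q k < C (Suc n)" using step(6) by blast
    then show "x \<notin> {p k..q k}" using lo[of "Suc n"] hi[of "Suc n"] by auto
  qed
qed


section \<open>The measure as a least upper bound\<close>

lemma interval_between_bounds:
  assumes "interval_between a b I"
  shows "a \<le> b" "{a<..<b} \<subseteq> I" "I \<subseteq> {a..b}"
  using assms by (auto simp: interval_between_def)

text \<open>In place of compactness, \<open>uncovered_point\<close> shows that finitely many
  covering intervals exhaust each inner interval up to an arbitrarily small \<open>\<delta>\<close>.
  Finitely many inner intervals are then compared with finitely many outer ones by exchanging two
  sums.\<close>

lemma inner_le_outer:
  assumes "disjoint_intervals I s" "disjoint_intervals J t" "(\<Union>n. I n) \<subseteq> (\<Union>n. J n)"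
  shows "s \<le> t"
proof (rule ccontr)
  assume "\<not> s \<le> t"
  obtain c e where I: "\<And>n. interval_between (c n) (e n) (I n)" "strongly_sums (\<lambda>n. e n - c n) s"
    using assms(1) by (auto simp: disjoint_intervals_def)
  obtain p q where J: "\<And>n. interval_between (p n) (q n) (J n)" "strongly_sums (\<lambda>n. q n - p n) t"
    using assms(2) by (auto simp: disjoint_intervals_def)
  have dis: "disjoint_family I" using assms(1) by (simp add: disjoint_intervals_def)
  have pq: "p k \<le> q k" for k using J(1) interval_between_bounds by blast
  define \<eta> where "\<eta> = s - t"
  have "\<eta> > 0" using \<open>\<not> s \<le> t\<close> by (simp add: \<eta>_def)
  then obtain N where "\<bar>(\<Sum>n<N. e n - c n) - s\<bar> < \<eta> / 2"
    using I(2) unfolding strongly_sums_def strongly_converges_def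
    by (metis half_gt_zero order_refl)
  then have N: "t + \<eta> / 2 < (\<Sum>n<N. e n - c n)"
    by (simp add: \<eta>_def abs_if field_simps split: if_splits)
  \<comment> \<open>The \<open>N\<close> errors together stay within the excess
    \<open>\<eta> / 2\<close>; \<open>Suc\<close> avoids a division by 0.\<close>
  define \<delta> where "\<delta> = \<eta> / 2 / of_nat (Suc N)"
  have "\<delta> > 0" unfolding \<delta>_def using \<open>\<eta> > 0\<close> by (intro divide_pos_pos of_nat_0_less_iff[THEN iffD2]) auto
  have "\<exists>K. e n - c n < (\<Sum>k<K. overlap (c n) (e n) (p k) (q k)) + \<delta>" for n
  proof (rule ccontr)
    assume "\<not> ?thesis"
    then have "(\<Sum>k<K. overlap (c n) (e n) (p k) (q k)) + \<delta> \<le> e n - c n" for K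
      by (simp add: not_less)
    with uncovered_point[OF pq strongly_sums_tail[OF J(2)] \<open>\<delta> > 0\<close>]
    obtain x where x: "c n < x" "x < e n" "\<And>k. x \<notin> {p k..q k}" by metis
    then have "x \<in> I n" using interval_between_bounds(2)[OF I(1)[of n]] by auto
    then obtain k where "x \<in> J k" using assms(3) by blast
    then show False using x(3)[of k] interval_between_bounds(3)[OF J(1)[of k]] by blast
  qed
  then obtain K where K: "\<And>n. e n - c n < (\<Sum>k<K n. overlap (c n) (e n) (p k) (q k)) + \<delta>" by metis
  define L where "L = Max (K ` {..N})"
  have "e n - c n \<le> (\<Sum>k<L. overlap (c n) (e n) (p k) (q k)) + \<delta>" if "n < N" for n
  proof -
    have "K n \<le> L" unfolding L_def using that by (intro Max_ge) auto
    then have "(\<Sum>k<K n. overlap (c n) (e n) (p k) (q k)) \<le> (\<Sum>k<L. overlap (c n) (e n) (p k) (q k))"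
      by (intro sum_mono2) auto
    then show ?thesis using K[of n] by linarith
  qed
  then have "(\<Sum>n<N. e n - c n) \<le> (\<Sum>n<N. (\<Sum>k<L. overlap (c n) (e n) (p k) (q k)) + \<delta>)"
    by (intro sum_mono) auto
  also have "\<dots> = (\<Sum>k<L. \<Sum>n<N. overlap (c n) (e n) (p k) (q k)) + of_nat N * \<delta>"
    by (simp add: sum.distrib sum.swap[of _ "{..<L}"])
  also have "\<dots> \<le> (\<Sum>k<L. q k - p k) + of_nat N * \<delta>"
  proof (intro add_right_mono sum_mono sum_overlap_le)
    fix i j :: nat assume "i \<noteq> j"
    then have "I i \<inter> I j = {}" using dis by (auto simp: disjoint_family_on_def)
    then show "{c i<..<e i} \<inter> {c j<..<e j} = {}"
      using interval_between_bounds(2)[OF I(1)] by blast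
  qed (use pq in auto)
  also have "\<dots> \<le> t + of_nat N * \<delta>"
    using strongly_sums_partial_le[OF J(2)] pq by simp
  also have "of_nat N * \<delta> \<le> of_nat (Suc N) * \<delta>"
    using \<open>\<delta> > 0\<close> by (intro mult_right_mono) auto
  also have "of_nat (Suc N) * \<delta> = \<eta> / 2"
    by (simp add: \<delta>_def del: of_nat_Suc)
  finally show False using N by simp
qed

text \<open>\<open>lc_measure\<close> is a \<open>LEAST\<close>, hence meaningless until the supremum is known to exist.\<close>

lemma inner_sum_le_measure:
  assumes "lc_measurable A" "r \<in> inner_sums A"
  shows "r \<le> lc_measure A"
proof -
  have "\<exists>s t J. s \<in> inner_sums A \<and> disjoint_intervals J t \<and> A \<subseteq> (\<Union>n. J n) \<and> t - s \<le> dpow (of_nat k)" for k :: nat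
    using assms(1) dpow_pos[of "of_nat k"] unfolding lc_measurable_def inner_sums_def by blast
  then obtain s t J where st: "\<And>k. s k \<in> inner_sums A" "\<And>k. disjoint_intervals (J k) (t k)"
    "\<And>k. A \<subseteq> (\<Union>n. J k n)" "\<And>k. t k - s k \<le> dpow (of_nat k)"
    by metis
  have le: "u \<le> t k" if "u \<in> inner_sums A" for u k
    using that inner_le_outer st(2,3) unfolding inner_sums_def by (smt (verit) mem_Collect_eq subset_trans)
  \<comment> \<open>Every inner sum is below \<open>t k\<close>, hence at most
    \<open>dpow (of_nat k)\<close> above \<open>s k\<close>. This makes \<open>s\<close> Cauchy and
    its limit the least upper bound.\<close>
  have near: "u \<le> s k + dpow (of_nat k)" if "u \<in> inner_sums A" for u k
    using le[OF that, of k] st(4)[of k] by linarith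
  obtain m where m: "strongly_converges s m"
  proof (rule strongly_Cauchy_converges[of s])
    fix \<epsilon> :: levi_civita assume "0 < \<epsilon>"
    then obtain N :: nat where N: "\<forall>n\<ge>N. dpow (of_nat n) < \<epsilon>" using dpow_less_pos by blast
    have "\<bar>s i - s j\<bar> < \<epsilon>" if "i \<ge> N" "j \<ge> N" for i j
    proof -
      have "dpow (of_nat i) < \<epsilon>" "dpow (of_nat j) < \<epsilon>" using N that by auto
      then show ?thesis using near[OF st(1)[of i], of j] near[OF st(1)[of j], of i]
        unfolding abs_less_iff by linarith
    qed
    then show "\<exists>N. \<forall>m\<ge>N. \<forall>n\<ge>N. \<bar>s m - s n\<bar> < \<epsilon>" by blast
  qed
  have upper: "u \<le> m" if "u \<in> inner_sums A" for u
  proof (rule ccontr)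
    assume "\<not> u \<le> m"
    then have pos: "0 < (u - m) / 2" by simp
    then obtain N :: nat where N: "\<forall>n\<ge>N. dpow (of_nat n) < (u - m) / 2" using dpow_less_pos by blast
    obtain M where M: "\<forall>n\<ge>M. \<bar>s n - m\<bar> < (u - m) / 2"
      using m pos unfolding strongly_converges_def by blast
    define n where "n = max N M"
    have "dpow (of_nat n) < (u - m) / 2" "\<bar>s n - m\<bar> < (u - m) / 2" using N M by (auto simp: n_def)
    then show False using near[OF that, of n] field_sum_of_halves[of "u - m"]
      unfolding abs_less_iff by linarith
  qed
  have "lc_measure A = m"
    unfolding lc_measure_def
  proof (rule Least_equality)
    show "\<forall>s\<in>inner_sums A. s \<le> m" using upper by blast
    fix y assume "\<forall>s\<in>inner_sums A. s \<le> y"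
    then show "m \<le> y" using strong_limit_le[OF m, of 0 y] st(1) by blast
  qed
  then show ?thesis using upper[OF assms(2)] by simp
qed

lemma lc_measure_nonneg:
  assumes "lc_measurable A" shows "0 \<le> lc_measure A"
proof (rule inner_sum_le_measure[OF assms])
  have "disjoint_intervals (\<lambda>n. {}) 0"
    unfolding disjoint_intervals_def strongly_sums_def strongly_converges_def
    by (auto simp: disjoint_family_on_def interval_between_def intro!: exI[of _ "\<lambda>_. 0"])
  then show "0 \<in> inner_sums A" unfolding inner_sums_def by blast
qed

text \<open>If all lengths were infinitesimal, a finite partial sum plus two errors
  \<open>dpow 1\<close> would bound the measure by an infinitesimal. The bounds \<open>u\<close> and
  \<open>v\<close> are the real parts of the endpoints of the interval found.\<close>

lemma noninfinitesimal_interval: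
  assumes "lc_measurable A" "A \<subseteq> {of_real a..of_real b}" "\<not> infinitesimal (lc_measure A)"
    and "g \<in> lc_measurable_funs A"
  obtains I u v where "simple_on I g" "u < v" "a \<le> u" "v \<le> b"
    "\<And>x. (\<And>q. q < 0 \<Longrightarrow> lc_nth x q = 0) \<Longrightarrow> u < lc_nth x 0 \<Longrightarrow> lc_nth x 0 < v \<Longrightarrow> x \<in> I"
proof -
  obtain I s where I: "disjoint_intervals I s" "(\<Union>n. I n) \<subseteq> A"
    "lc_measure A - s < dpow 1" "\<And>n. simple_on (I n) g"
    using assms(4) dpow_pos[of 1] unfolding lc_measurable_funs_def by blast
  obtain c e where ce: "\<And>n. interval_between (c n) (e n) (I n)" "strongly_sums (\<lambda>n. e n - c n) s"
    using I(1) by (auto simp: disjoint_intervals_def)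
  have "\<exists>n. \<not> infinitesimal (e n - c n)"
  proof (rule ccontr)
    assume "\<not> ?thesis"
    then have inf: "infinitesimal (\<Sum>n<N. e n - c n)" for N
      by (intro infinitesimal_sum) auto
    obtain N where "\<bar>(\<Sum>n<N. e n - c n) - s\<bar> < dpow 1"
      using ce(2) dpow_pos[of 1] unfolding strongly_sums_def strongly_converges_def by blast
    then have "lc_measure A \<le> (\<Sum>n<N. e n - c n) + dpow 1 + dpow 1"
      using I(3) unfolding abs_less_iff by linarith
    moreover have "infinitesimal ((\<Sum>n<N. e n - c n) + dpow 1 + dpow 1)"
      by (intro infinitesimal_add inf infinitesimal_dpow) auto
    ultimately have "infinitesimal (lc_measure A)"
      using infinitesimal_abs_le lc_measure_nonneg[OF assms(1)] by (metis abs_of_nonneg)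
    then show False using assms(3) by simp
  qed
  then obtain n where n: "\<not> infinitesimal (e n - c n)" by blast
  let ?c = "c n" and ?e = "e n"
  have ne: "?c < ?e" using n interval_between_bounds(1)[OF ce(1)[of n]]
    by (cases "?c = ?e") (auto simp: infinitesimal_iff)
  have sub: "{?c<..<?e} \<subseteq> {of_real a..of_real b}"
    using interval_between_bounds(2)[OF ce(1)[of n]] I(2) assms(2) by blast
  have "of_real a \<le> ?c"
  proof (rule ccontr)
    assume "\<not> ?thesis"
    then obtain x where "?c < x" "x < min ?e (of_real a)" using ne dense[of ?c "min ?e (of_real a)"] by auto
    then show False using sub by force
  qed
  moreover have "?e \<le> of_real b"
  proof (rule ccontr)
    assume "\<not> ?thesis"
    then obtain x where "max ?c (of_real b) < x" "x < ?e" using ne dense[of "max ?c (of_real b)" ?e] by auto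
    then show False using sub by force
  qed
  ultimately have mem: "?c \<in> {of_real a..of_real b}" "?e \<in> {of_real a..of_real b}" using ne by auto
  note dec = standard_decomposition[OF mem(1)] standard_decomposition[OF mem(2)]
  have neg: "lc_nth ?c q = 0" "lc_nth ?e q = 0" if "q < 0" for q
    using dec(2,4) that by (auto simp: infinitesimal_iff)
  have "lc_nth ?c 0 < lc_nth ?e 0"
  proof (rule ccontr)
    assume *: "\<not> ?thesis"
    have "lc_nth ?c 0 = lc_nth ?e 0"
    proof (rule ccontr)
      assume "lc_nth ?c 0 \<noteq> lc_nth ?e 0"
      then have "?e < ?c" using * neg by (auto simp: lc_less_iff intro!: exI[of _ 0])
      then show False using ne by simp
    qed
    then have "infinitesimal (?e - ?c)" using neg by (auto simp: infinitesimal_iff le_less)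
    then show False using n by simp
  qed
  moreover have "x \<in> I n" if "\<And>q. q < 0 \<Longrightarrow> lc_nth x q = 0" "lc_nth ?c 0 < lc_nth x 0" "lc_nth x 0 < lc_nth ?e 0" for x
  proof -
    have "?c < x" "x < ?e" using that neg by (auto simp: lc_less_iff intro!: exI[of _ 0])
    then show ?thesis using interval_between_bounds(2)[OF ce(1)[of n]] by auto
  qed
  ultimately show ?thesis using that[OF I(4)[of n]] dec(1,3) by auto
qed


section \<open>Uniform bounds from the Baire category theorem\<close>

text \<open>The points where the bound holds from index \<open>N\<close> on form a closed set, and
  these sets cover \<open>V\<close>; one of them has an interior point.\<close>

lemma Baire_uniform_bound:
  fixes h :: "nat \<Rightarrow> 'q \<Rightarrow> 'a::complete_space \<Rightarrow> real"
  assumes "open V" "V \<noteq> {}"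
    and cont: "\<And>K q. q \<in> Q \<Longrightarrow> continuous_on UNIV (h K q)"
    and bd: "\<And>x. x \<in> V \<Longrightarrow> \<exists>N. \<forall>K\<ge>N. \<forall>q\<in>Q. \<bar>h K q x\<bar> \<le> B"
  obtains W N where "open W" "W \<noteq> {}" "W \<subseteq> V"
    "\<And>x K q. x \<in> W \<Longrightarrow> N \<le> K \<Longrightarrow> q \<in> Q \<Longrightarrow> \<bar>h K q x\<bar> \<le> B"
proof -
  \<comment> \<open>Intersecting with \<open>closure V\<close> forces any interior of
    \<open>E N\<close> to meet \<open>V\<close>.\<close>
  define E where "E N = (\<Inter>K\<in>{N..}. \<Inter>q\<in>Q. {x. \<bar>h K q x\<bar> \<le> B}) \<inter> closure V" for N :: nat
  have closed: "closed (E N)" for N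
    unfolding E_def using cont
    by (intro closed_Int closed_INT ballI closed_Collect_le continuous_intros) auto
  have "V \<subseteq> (\<Union>N. E N)"
  proof
    fix x assume x: "x \<in> V"
    then obtain N where "\<forall>K\<ge>N. \<forall>q\<in>Q. \<bar>h K q x\<bar> \<le> B" using bd by blast
    then have "x \<in> E N" using x closure_subset unfolding E_def by auto
    then show "x \<in> (\<Union>N. E N)" by blast
  qed
  then have "V \<subseteq> interior (\<Union>N. E N)" using assms(1) by (rule interior_maximal)
  then have ne: "interior (\<Union>(range E)) \<noteq> {}" using assms(2) by auto
  have complete: "Met_TC.mcomplete TYPE('a)"
    unfolding Met_TC.mcomplete_def using Cauchy_convergent[where 'a='a] by (simp add: convergent_def)
  have "\<exists>N. interior (E N) \<noteq> {}"
  proof (rule ccontr)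
    assume "\<not> ?thesis"
    then have "Met_TC.mtopology interior_of \<Union>(range E) = {}"
      using closed by (intro Met_TC.metric_Baire_category_alt[OF complete]) auto
    then show False using ne by simp
  qed
  then obtain N where N: "interior (E N) \<noteq> {}" by blast
  have "interior (E N) \<subseteq> closure V" using interior_subset unfolding E_def by blast
  then have "interior (E N) \<inter> V \<noteq> {}"
    using N open_Int_closure_eq_empty[of "interior (E N)" V] by auto
  moreover have "\<bar>h K q x\<bar> \<le> B" if "x \<in> interior (E N) \<inter> V" "N \<le> K" "q \<in> Q" for x K q
    using that interior_subset[of "E N"] unfolding E_def by auto
  ultimately show ?thesis using that[of "interior (E N) \<inter> V" N] assms(1) by auto
qed


section \<open>Sequences of real polynomials\<close>

text \<open>Replacing \<open>g(c)\<close> by \<open>g(2 c) - 2^m g(c)\<close> removes the top coefficient and rescales the others.\<close>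

lemma coeffs_tendsto_0:
  fixes \<alpha> :: "nat \<Rightarrow> nat \<Rightarrow> real"
  assumes "\<And>c. (\<lambda>K. \<Sum>i\<le>m. \<alpha> K i * c ^ i) \<longlonglongrightarrow> 0" "i \<le> m"
  shows "(\<lambda>K. \<alpha> K i) \<longlonglongrightarrow> 0"
  using assms
proof (induction m arbitrary: \<alpha> i)
  case 0
  then show ?case using 0(1)[of 1] by simp
next
  case (Suc m)
  define w :: "nat \<Rightarrow> real" where "w i = 2 ^ i - 2 ^ Suc m" for i
  have low: "(\<lambda>K. \<alpha> K i) \<longlonglongrightarrow> 0" if "i \<le> m" for i
  proof -
    have "(\<lambda>K. \<Sum>i\<le>m. (\<alpha> K i * w i) * c ^ i) \<longlonglongrightarrow> 0" for c
    proof -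
      have "(\<lambda>K. (\<Sum>i\<le>Suc m. \<alpha> K i * (2 * c) ^ i) - 2 ^ Suc m * (\<Sum>i\<le>Suc m. \<alpha> K i * c ^ i))
          \<longlonglongrightarrow> 0 - 2 ^ Suc m * 0"
        by (intro tendsto_intros Suc.prems(1))
      moreover have "(\<Sum>i\<le>Suc m. \<alpha> K i * (2 * c) ^ i) - 2 ^ Suc m * (\<Sum>i\<le>Suc m. \<alpha> K i * c ^ i)
          = (\<Sum>i\<le>m. (\<alpha> K i * w i) * c ^ i)" for K
      proof -
        have "(\<Sum>i\<le>Suc m. \<alpha> K i * (2 * c) ^ i) - 2 ^ Suc m * (\<Sum>i\<le>Suc m. \<alpha> K i * c ^ i)
            = (\<Sum>i\<le>Suc m. \<alpha> K i * (2 * c) ^ i - 2 ^ Suc m * (\<alpha> K i * c ^ i))"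
          by (simp only: sum_distrib_left sum_subtractf)
        also have "\<dots> = (\<Sum>i\<le>Suc m. (\<alpha> K i * w i) * c ^ i)"
          by (intro sum.cong refl) (simp only: w_def power_mult_distrib left_diff_distrib right_diff_distrib mult_ac)
        also have "\<dots> = (\<Sum>i\<le>m. (\<alpha> K i * w i) * c ^ i)" by (simp add: w_def)
        finally show ?thesis .
      qed
      ultimately show ?thesis by simp
    qed
    then have "(\<lambda>K. \<alpha> K i * w i) \<longlonglongrightarrow> 0" using that by (rule Suc.IH[where \<alpha> = "\<lambda>K i. \<alpha> K i * w i"])
    moreover have "(2::real) ^ i < 2 ^ Suc m"
      using that by (intro power_strict_increasing) auto
    ultimately show ?thesis
      using tendsto_divide[of "\<lambda>K. \<alpha> K i * w i" 0 sequentially "\<lambda>_. w i" "w i"] by (simp add: w_def)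
  qed
  have "(\<lambda>K. (\<Sum>i\<le>Suc m. \<alpha> K i * 1 ^ i) - (\<Sum>i\<le>m. \<alpha> K i)) \<longlonglongrightarrow> 0 - (\<Sum>i\<le>m. 0)"
    by (intro tendsto_diff tendsto_sum low Suc.prems(1)) auto
  then have "(\<lambda>K. \<alpha> K (Suc m)) \<longlonglongrightarrow> 0" by simp
  then show ?case using low Suc.prems(2) by (auto simp: le_Suc_eq)
qed

text \<open>The polynomials \<open>g(K c) / K\<close> tend to 0, hence so do their coefficients \<open>\<alpha> i * K^(i - 1)\<close>.\<close>

lemma bounded_polynomial_coeff_0:
  fixes \<alpha> :: "nat \<Rightarrow> real"
  assumes "\<And>c. \<bar>\<Sum>i\<le>m. \<alpha> i * c ^ i\<bar> \<le> B" "1 \<le> i" "i \<le> m"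
  shows "\<alpha> i = 0"
proof -
  have "(\<lambda>K. \<Sum>i\<le>m. \<alpha> i * real K ^ i / real K * c ^ i) \<longlonglongrightarrow> 0" for c
  proof (rule Lim_null_comparison)
    show "(\<lambda>K. B / real K) \<longlonglongrightarrow> 0" by (rule lim_const_over_n)
    have "(\<Sum>i\<le>m. \<alpha> i * real K ^ i / real K * c ^ i) = (\<Sum>i\<le>m. \<alpha> i * (K * c) ^ i) / K" for K
      by (simp add: sum_divide_distrib power_mult_distrib mult_ac)
    then show "\<forall>\<^sub>F K in sequentially. norm (\<Sum>i\<le>m. \<alpha> i * real K ^ i / real K * c ^ i) \<le> B / real K"
      using assms(1) by (intro always_eventually) (auto simp: divide_right_mono)
  qed
  then have "(\<lambda>K. \<alpha> i * real K ^ i / real K) \<longlonglongrightarrow> 0"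
    using assms(3) by (rule coeffs_tendsto_0[where \<alpha> = "\<lambda>K i. \<alpha> i * real K ^ i / real K"])
  then have "(\<lambda>K. \<bar>\<alpha> i * real K ^ i / real K\<bar>) \<longlonglongrightarrow> 0" by (rule tendsto_rabs_zero)
  moreover have "\<forall>\<^sub>F K in sequentially. \<bar>\<alpha> i\<bar> \<le> \<bar>\<alpha> i * real K ^ i / real K\<bar>"
    using eventually_ge_at_top[of 1]
  proof eventually_elim
    case (elim K)
    then have "real K ^ 1 \<le> real K ^ i" using assms(2) by (intro power_increasing) auto
    then have "\<bar>\<alpha> i\<bar> * 1 \<le> \<bar>\<alpha> i\<bar> * (real K ^ i / real K)"
      using elim by (intro mult_left_mono) auto
    then show ?case by (simp add: abs_mult)
  qed
  ultimately have "\<bar>\<alpha> i\<bar> \<le> 0" by (rule tendsto_lowerbound) simp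
  then show ?thesis by simp
qed

lemma pderiv_surj:
  fixes p :: "'a::field_char_0 poly" shows "\<exists>r. pderiv r = p"
proof
  have "pderiv (\<Sum>i\<le>degree p. monom (coeff p i / of_nat (Suc i)) (Suc i)) = (\<Sum>i\<le>degree p. monom (coeff p i) i)"
    using higher_pderiv_sum[of 1 "\<lambda>i. monom (coeff p i / of_nat (Suc i)) (Suc i)" "{..degree p}"]
    by (simp add: pderiv_monom del: of_nat_Suc)
  then show "pderiv (\<Sum>i\<le>degree p. monom (coeff p i / of_nat (Suc i)) (Suc i)) = p"
    by (simp add: poly_as_sum_of_monoms)
qed

lemma poly_pderiv_has_integral:
  fixes p :: "real poly"
  assumes "u \<le> y" shows "(poly (pderiv p) has_integral poly p y - poly p u) {u..y}"
  using assms by (intro fundamental_theorem_of_calculus)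
    (auto simp: has_real_derivative_iff_has_vector_derivative[symmetric] intro: poly_DERIV DERIV_subset)

text \<open>Induction on \<open>m\<close>, integrating once per step: the derivatives converge
  boundedly to a polynomial, so dominated convergence makes \<open>g 0\<close> one of its
  antiderivatives. The bound \<open>B\<close> in the conclusion supplies the domination for the next
  integration.\<close>

lemma limit_of_polynomials:
  fixes p :: "nat \<Rightarrow> real poly" and g :: "nat \<Rightarrow> real \<Rightarrow> real"
  assumes "u \<le> v"
    and "\<And>j y. j \<le> m \<Longrightarrow> y \<in> {u..v} \<Longrightarrow> (\<lambda>K. poly ((pderiv ^^ j) (p K)) y) \<longlonglongrightarrow> g j y"
    and "\<And>y. y \<in> {u..v} \<Longrightarrow> g m y = 0"
    and "\<And>K y. y \<in> {u..v} \<Longrightarrow> \<bar>poly ((pderiv ^^ m) (p K)) y\<bar> \<le> B"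
  shows "\<exists>r B. \<forall>y\<in>{u..v}. g 0 y = poly r y \<and> (\<forall>K. \<bar>poly (p K) y\<bar> \<le> B)"
  using assms(2-)
proof (induction m arbitrary: p g)
  case 0
  then show ?case by (intro exI[of _ 0] exI[of _ B]) auto
next
  case (Suc m)
  have "\<exists>r B. \<forall>y\<in>{u..v}. (\<lambda>j. g (Suc j)) 0 y = poly r y \<and> (\<forall>K. \<bar>poly (pderiv (p K)) y\<bar> \<le> B)"
  proof (rule Suc.IH)
    show "(\<lambda>K. poly ((pderiv ^^ j) (pderiv (p K))) y) \<longlonglongrightarrow> g (Suc j) y" if "j \<le> m" "y \<in> {u..v}" for j y
      using Suc.prems(1)[of "Suc j" y] that by (simp add: funpow_swap1)
    show "\<bar>poly ((pderiv ^^ m) (pderiv (p K))) y\<bar> \<le> B" if "y \<in> {u..v}" for K y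
      using Suc.prems(3)[of y K] that by (simp add: funpow_swap1)
  qed (use Suc.prems(2) in auto)
  then obtain r B1 where r: "\<And>y. y \<in> {u..v} \<Longrightarrow> g (Suc 0) y = poly r y"
    "\<And>y K. y \<in> {u..v} \<Longrightarrow> \<bar>poly (pderiv (p K)) y\<bar> \<le> B1" by blast
  obtain R where R: "pderiv R = r" using pderiv_surj by blast
  have lim0: "(\<lambda>K. poly (p K) y) \<longlonglongrightarrow> g 0 y" if "y \<in> {u..v}" for y
    using Suc.prems(1)[of 0 y] that by simp
  have "g 0 y = poly ([:g 0 u - poly R u:] + R) y" if y: "y \<in> {u..v}" for y
  proof -
    have "((\<lambda>x. poly r x) has_integral g 0 y - g 0 u) {u..y}"
    proof (rule has_integral_dominated_convergence)
      show "(poly (pderiv (p K)) has_integral poly (p K) y - poly (p K) u) {u..y}" for K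
        using y by (intro poly_pderiv_has_integral) auto
      show "(\<lambda>_. B1) integrable_on {u..y}" by (rule integrable_const_ivl)
      show "\<forall>x\<in>{u..y}. norm (poly (pderiv (p K)) x) \<le> B1" for K using r(2) y by auto
      show "\<forall>x\<in>{u..y}. (\<lambda>K. poly (pderiv (p K)) x) \<longlonglongrightarrow> poly r x"
        using Suc.prems(1)[of "Suc 0"] r(1) y by auto
      show "(\<lambda>K. poly (p K) y - poly (p K) u) \<longlonglongrightarrow> g 0 y - g 0 u"
        using y by (intro tendsto_diff lim0) auto
    qed
    moreover have "(poly r has_integral poly R y - poly R u) {u..y}"
      using poly_pderiv_has_integral[of u y R] y R by simp
    ultimately have "g 0 y - g 0 u = poly R y - poly R u" by (rule has_integral_unique)
    then show ?thesis by simp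
  qed
  moreover obtain C where C: "\<And>K. \<bar>poly (p K) u\<bar> \<le> C"
    using convergent_imp_Bseq[OF convergentI[OF lim0[of u]]] assms(1) unfolding Bseq_def by auto
  have "\<bar>poly (p K) y\<bar> \<le> C + B1 * (v - u)" if y: "y \<in> {u..v}" for K y
  proof -
    have "norm (poly (p K) y - poly (p K) u) \<le> B1 * norm (y - u)"
      using y r(2)
      by (intro field_differentiable_bound[of "{u..v}" "poly (p K)" "poly (pderiv (p K))"])
         (auto intro: poly_DERIV DERIV_subset)
    also have "\<dots> \<le> B1 * (v - u)"
      using y order_trans[OF abs_ge_zero r(2)[OF y]] by (intro mult_left_mono) auto
    finally show ?thesis using C[of K] by auto
  qed
  ultimately show ?case by blast
qed

text \<open>Composition with \<open>[:y, 1:]\<close> recentres \<open>r\<close> at \<open>y\<close>;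
  the power series is then a finite sum.\<close>

lemma polynomial_locally_analytic:
  assumes "\<And>x. \<bar>x - y\<bar> < \<delta> \<Longrightarrow> f x = poly r x" "0 < \<delta>"
  shows "locally_analytic_within S f y"
proof -
  let ?r = "pcompose r [:y, 1:]"
  have "(\<lambda>k. coeff ?r k * (x - y) ^ k) sums f x" if "\<bar>x - y\<bar> < \<delta>" for x
  proof -
    have "(\<lambda>k. coeff ?r k * (x - y) ^ k) sums (\<Sum>k\<le>degree ?r. coeff ?r k * (x - y) ^ k)"
      by (rule sums_finite) (auto intro: coeff_eq_0)
    then show ?thesis using assms(1)[OF that] by (simp add: poly_altdef[symmetric] poly_pcompose)
  qed
  then show ?thesis unfolding locally_analytic_within_def using assms(2) by blast
qed


section \<open>Polynomials over the Levi-Civita field\<close>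

text \<open>At real points, evaluation commutes with taking the coefficient at \<open>q\<close>, so
  the levels split a polynomial over the field into real polynomials.\<close>

definition level :: "rat \<Rightarrow> levi_civita poly \<Rightarrow> real poly" where
  "level q p = map_poly (\<lambda>z. lc_nth z q) p"

lemma coeff_level [simp]: "coeff (level q p) i = lc_nth (coeff p i) q"
  by (simp add: level_def coeff_map_poly)

lemma lc_nth_of_real_mult [simp]: "lc_nth (of_real r * z) q = r * lc_nth z q"
  by (simp flip: scaleR_conv_of_real)

lemma lc_nth_of_nat_mult [simp]: "lc_nth (of_nat k * z) q = of_nat k * lc_nth z q"
  by (metis lc_nth_of_real_mult of_real_of_nat_eq)

lemma lc_nth_divide_fact [simp]: "lc_nth (z / fact i) q = lc_nth z q / fact i"
proof -
  have "z / fact i = of_real (1 / fact i) * z" by simp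
  then show ?thesis by (simp only: lc_nth_of_real_mult) simp
qed

lemma level_pderiv: "level q ((pderiv ^^ i) p) = (pderiv ^^ i) (level q p)"
proof -
  have "level q (pderiv p) = pderiv (level q p)" for p
    by (rule poly_eqI) (simp add: coeff_pderiv del: of_nat_Suc)
  then show ?thesis by (induction i) auto
qed

lemma poly_level: "lc_nth (poly p (of_real y)) q = poly (level q p) y"
proof (induction p)
  case (pCons a p)
  have "level q (pCons a p) = pCons (lc_nth a q) (level q p)"
    by (rule poly_eqI) (simp add: coeff_pCons split: nat.split)
  then show ?case using pCons by simp
qed (simp add: level_def)

lemma poly_Taylor:
  fixes p :: "'a::field_char_0 poly"
  assumes "degree p \<le> M"
  shows "poly p (x + h) = (\<Sum>i\<le>M. poly ((pderiv ^^ i) p) x / fact i * h ^ i)"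
proof -
  let ?r = "pcompose p [:x, 1:]"
  have "(pderiv ^^ i) ?r = pcompose ((pderiv ^^ i) p) [:x, 1:]" for i
    by (induction i) (auto simp: pderiv_pcompose pderiv_pCons)
  then have "poly ((pderiv ^^ i) p) x = coeff ((pderiv ^^ i) ?r) 0" for i
    by (simp add: poly_pcompose flip: poly_0_coeff_0)
  then have *: "coeff ?r i = poly ((pderiv ^^ i) p) x / fact i" for i
    by (simp add: coeff_higher_pderiv flip: pochhammer_fact)
  have "degree ?r \<le> M" using assms by (simp add: degree_pcompose)
  then have "poly ?r h = (\<Sum>i\<le>M. coeff ?r i * h ^ i)"
    unfolding poly_altdef by (intro sum.mono_neutral_left) (auto simp: coeff_eq_0)
  then show ?thesis by (simp add: poly_pcompose *)
qed

text \<open>Taylor expansion at \<open>y\<close>: the factor \<open>dpow s ^ i\<close> moves the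
  exponent that is read from \<open>q\<close> to \<open>q - i s\<close>. Hence each coefficient of
  the value is a real polynomial in \<open>c\<close>.\<close>

lemma lc_nth_poly_shift:
  assumes "degree p \<le> M"
  shows "lc_nth (poly p (of_real y + of_real c * dpow s)) q =
    (\<Sum>i\<le>M. poly ((pderiv ^^ i) (level (q - of_nat i * s) p)) y / fact i * c ^ i)"
proof -
  have "lc_nth (z * (of_real c * dpow s) ^ i) q = c ^ i * lc_nth z (q - of_nat i * s)" for z i
  proof -
    have "z * (of_real c * dpow s) ^ i = of_real (c ^ i) * (z * dpow (of_nat i * s))"
      by (simp add: power_mult_distrib dpow_power mult_ac)
    then show ?thesis by (simp only: lc_nth_of_real_mult lc_nth_mult_dpow)
  qed
  then show ?thesis
    by (simp add: poly_Taylor[OF assms] poly_level level_pderiv mult_ac)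
qed


section \<open>Continuous families of Levi-Civita numbers\<close>

text \<open>The common left-finite set \<open>W\<close> lets every coefficient of a product be a sum
  over one finite index set for all parameters, so that products preserve continuity.\<close>

definition continuous_family :: "('a::topological_space \<Rightarrow> levi_civita) \<Rightarrow> bool" where
  "continuous_family z \<longleftrightarrow> (\<exists>W. left_finite W \<and> (\<forall>c. lc_supp (z c) \<subseteq> W)) \<and>
     (\<forall>q. continuous_on UNIV (\<lambda>c. lc_nth (z c) q))"

lemma continuous_family_const: "continuous_family (\<lambda>_. a)"
  unfolding continuous_family_def using left_finite_supp by (auto intro!: exI[of _ "lc_supp a"])

lemma continuous_family_add:
  assumes "continuous_family y" "continuous_family z"
  shows "continuous_family (\<lambda>c. y c + z c)"
proof -
  obtain V W where "left_finite V" "left_finite W" and VW: "\<And>c. lc_supp (y c) \<subseteq> V" "\<And>c. lc_supp (z c) \<subseteq> W"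
    using assms unfolding continuous_family_def by blast
  then have "left_finite (V \<union> W)" by (intro left_finite_Un)
  moreover have "lc_supp (y c + z c) \<subseteq> V \<union> W" for c using VW[of c] by fastforce
  moreover have "continuous_on UNIV (\<lambda>c. lc_nth (y c + z c) q)" for q
    using assms unfolding continuous_family_def by (auto intro: continuous_intros)
  ultimately show ?thesis unfolding continuous_family_def by blast
qed

lemma continuous_family_mult:
  assumes "continuous_family y" "continuous_family z"
  shows "continuous_family (\<lambda>c. y c * z c)"
proof -
  obtain V W where lf: "left_finite V" "left_finite W"
    and VW: "\<And>c. lc_supp (y c) \<subseteq> V" "\<And>c. lc_supp (z c) \<subseteq> W"
    using assms unfolding continuous_family_def by blast
  define S where "S q = fst ` {(p, r). p \<in> V \<and> r \<in> W \<and> p + r \<le> q}" for q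
  have fin: "finite (S q)" for q
    unfolding S_def using left_finite_pairs[OF lf] by (rule finite_imageI)
  have nth: "lc_nth (y c * z c) q = (\<Sum>p\<in>S q. lc_nth (y c) p * lc_nth (z c) (q - p))" for c q
  proof (rule lc_mult_nth[OF fin])
    fix p assume "lc_nth (y c) p \<noteq> 0" "lc_nth (z c) (q - p) \<noteq> 0"
    then have "p \<in> V" "q - p \<in> W" using VW by auto
    then show "p \<in> S q" unfolding S_def by (intro image_eqI[of _ _ "(p, q - p)"]) auto
  qed
  have "lc_supp (y c * z c) \<subseteq> {p + r | p r. p \<in> V \<and> r \<in> W}" for c
  proof
    fix q assume "q \<in> lc_supp (y c * z c)"
    then obtain p where "lc_nth (y c) p * lc_nth (z c) (q - p) \<noteq> 0"
      unfolding nth mem_Collect_eq by (meson sum.not_neutral_contains_not_neutral)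
    then have "p \<in> V" "q - p \<in> W" using VW by auto
    moreover have "q = p + (q - p)" by simp
    ultimately show "q \<in> {p + r | p r. p \<in> V \<and> r \<in> W}" by blast
  qed
  moreover have "continuous_on UNIV (\<lambda>c. lc_nth (y c * z c) q)" for q
    unfolding nth using assms unfolding continuous_family_def by (intro continuous_intros) auto
  ultimately show ?thesis unfolding continuous_family_def using left_finite_sums[OF lf] by blast
qed

lemma continuous_family_poly:
  assumes "continuous_family z" shows "continuous_family (\<lambda>c. poly p (z c))"
proof (induction p)
  case (pCons a p)
  have "continuous_family (\<lambda>c. a + z c * poly p (z c))"
    by (intro continuous_family_add continuous_family_const continuous_family_mult assms pCons.IH)
  then show ?case by simp
qed (simp add: continuous_family_const)

text \<open>The element \<open>\<Sum> c k d^k\<close>, which embeds the Polish space of real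
  sequences.\<close>

lift_definition from_coeffs :: "(nat \<Rightarrow> real) \<Rightarrow> levi_civita"
  is "\<lambda>c q. if q \<in> \<nat> then c (nat \<lfloor>q\<rfloor>) else 0"
proof -
  fix c :: "nat \<Rightarrow> real"
  have "finite {x \<in> \<nat>. x \<le> (q::rat)}" for q
  proof (rule finite_subset)
    show "{x \<in> \<nat>. x \<le> q} \<subseteq> of_nat ` {..nat \<lfloor>q\<rfloor>}"
      by (auto elim!: Nats_cases simp: le_nat_iff le_floor_iff intro!: imageI)
  qed simp
  then have "left_finite \<nat>" by (simp add: left_finite_def)
  then show "left_finite {q. (if q \<in> \<nat> then c (nat \<lfloor>q\<rfloor>) else 0) \<noteq> 0}"
    by (rule left_finite_subset) auto
qed

lemma from_coeffs_nth: "lc_nth (from_coeffs c) (of_nat k) = c k"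
  by (simp add: from_coeffs.rep_eq)

lemma from_coeffs_neg: "q < 0 \<Longrightarrow> lc_nth (from_coeffs c) q = 0"
  by (auto simp: from_coeffs.rep_eq elim: Nats_cases)

lemma continuous_family_from_coeffs: "continuous_family from_coeffs"
proof -
  have "lc_supp (from_coeffs c) \<subseteq> lc_supp (from_coeffs (\<lambda>_. 1))" for c
    by (auto simp: from_coeffs.rep_eq)
  moreover have "continuous_on UNIV (\<lambda>c. lc_nth (from_coeffs c) q)" for q
    by (cases "q \<in> \<nat>") (auto simp: from_coeffs.rep_eq continuous_on_product_coordinates)
  ultimately show ?thesis unfolding continuous_family_def using left_finite_supp by blast
qed

text \<open>Separates the real part \<open>y\<close> and the free coordinate \<open>\<gamma>\<close>
  from a remainder depending on neither.\<close>

lemma from_coeffs_upd: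
  assumes "0 < s"
  shows "from_coeffs (c(0 := y, s := \<gamma>)) =
    of_real y + of_real \<gamma> * dpow (of_nat s) + from_coeffs (c(0 := 0, s := 0))"
  unfolding lc_eq_iff
proof
  fix q :: rat
  show "lc_nth (from_coeffs (c(0 := y, s := \<gamma>))) q =
    lc_nth (of_real y + of_real \<gamma> * dpow (of_nat s) + from_coeffs (c(0 := 0, s := 0))) q"
  proof (cases "q \<in> \<nat>")
    case True
    then obtain k where "q = of_nat k" by (rule Nats_cases)
    then show ?thesis using assms by (auto simp: from_coeffs_nth)
  next
    case False
    then have "q \<noteq> 0" "q \<noteq> of_nat s" by auto
    then show ?thesis using False by (simp add: from_coeffs.rep_eq)
  qed
qed


section \<open>Weak limits of polynomials\<close>

lemma weak_pointwise:
  assumes "weakly_converges s l" shows "(\<lambda>K. lc_nth (s K) q) \<longlonglongrightarrow> lc_nth l q"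
proof (rule LIMSEQ_I)
  fix e :: real assume "0 < e"
  \<comment> \<open>Small enough that \<open>q\<close> is among the exponents controlled by the
    seminorm.\<close>
  define \<epsilon> where "\<epsilon> = min e (inverse (max 1 (of_rat q)))"
  have "0 < \<epsilon>" using \<open>0 < e\<close> by (simp add: \<epsilon>_def)
  moreover have "of_rat q \<le> inverse \<epsilon>"
  proof -
    have "\<epsilon> \<le> inverse (max 1 (of_rat q))" by (simp add: \<epsilon>_def)
    then have "inverse (inverse (max 1 (of_rat q))) \<le> inverse \<epsilon>"
      using \<open>0 < \<epsilon>\<close> by (rule le_imp_inverse_le)
    then show ?thesis by simp
  qed
  ultimately obtain N where "\<And>K. K \<ge> N \<Longrightarrow> \<bar>lc_nth (s K - l) q\<bar> < \<epsilon>"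
    using assms unfolding weakly_converges_def weak_seminorm_less_iff by blast
  then show "\<exists>N. \<forall>K\<ge>N. norm (lc_nth (s K) q - lc_nth l q) < e"
    by (intro exI[of _ N]) (auto simp: \<epsilon>_def)
qed

text \<open>The seminorm with parameter 1 controls all exponents up to 1 at once, so one
  \<open>N\<close> serves every negative \<open>q\<close>.\<close>

lemma weak_uniform_below:
  assumes "weakly_converges s l"
  shows "\<exists>N. \<forall>K\<ge>N. \<forall>q<0. \<bar>lc_nth (s K - l) q\<bar> \<le> 1"
proof -
  obtain N where N: "\<And>K q. K \<ge> N \<Longrightarrow> of_rat q \<le> (1::real) \<Longrightarrow> \<bar>lc_nth (s K - l) q\<bar> < 1"
    using assms[unfolded weakly_converges_def weak_seminorm_less_iff, rule_format, of 1] by auto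
  have "\<bar>lc_nth (s K - l) q\<bar> \<le> 1" if "K \<ge> N" "q < 0" for K q
  proof -
    have "of_rat q < (0::real)" using that by simp
    then show ?thesis using N[OF that(1), of q] by linarith
  qed
  then show ?thesis by blast
qed

lemma weakly_converges_shift:
  assumes "weakly_converges s l" shows "weakly_converges (\<lambda>K. s (K + N)) l"
  using assms unfolding weakly_converges_def by (meson trans_le_add1)

text \<open>Positive powers of an infinitesimal are infinitesimal, so only the term with
  \<open>i = 0\<close> is seen at exponents up to 0.\<close>

lemma order_ext_nth:
  assumes "infinitesimal \<eta>"
  shows "q < 0 \<Longrightarrow> lc_nth (order_ext a b n f (of_real r + \<eta>)) q = 0"
    and "lc_nth (order_ext a b n f (of_real r + \<eta>)) 0 = f r"
proof -
  have pow: "infinitesimal (\<eta> ^ Suc i)" for i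
    using assms by (induction i) (auto intro: infinitesimal_mult)
  then have *: "lc_nth (\<eta> ^ i) q = (if i = 0 \<and> q = 0 then 1 else 0)" if "q \<le> 0" for i q
    using that by (cases i) (auto simp: infinitesimal_iff simp del: power_Suc)
  show "lc_nth (order_ext a b n f (of_real r + \<eta>)) q = 0" if "q < 0"
    using that by (simp add: order_ext_eq[OF assms] *)
  show "lc_nth (order_ext a b n f (of_real r + \<eta>)) 0 = f r"
    by (simp add: order_ext_eq[OF assms] * if_distrib if_distribR cong: if_cong) 
qed

text \<open>The coefficient at the negative exponent \<open>q + s\<close> is a bounded polynomial in
  \<open>c\<close>, so its linear coefficient, the derivative of \<open>level q p\<close> at
  \<open>y\<close>, vanishes. This happens at infinitely many \<open>y\<close>.\<close>

lemma level_pderiv_eq_0: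
  assumes "u < v" "0 < s"
    and bd: "\<And>y c q. u < y \<Longrightarrow> y < v \<Longrightarrow> q < 0 \<Longrightarrow> \<bar>lc_nth (poly p (of_real y + of_real c * dpow s)) q\<bar> \<le> B"
    and "q < - s"
  shows "pderiv (level q p) = 0"
proof (rule ccontr)
  assume "pderiv (level q p) \<noteq> 0"
  then have "finite {y. poly (pderiv (level q p)) y = 0}" by (rule poly_roots_finite)
  moreover have "{u<..<v} \<subseteq> {y. poly (pderiv (level q p)) y = 0}"
  proof safe
    fix y assume y: "y \<in> {u<..<v}"
    let ?\<alpha> = "\<lambda>i. poly ((pderiv ^^ i) (level (q + s - of_nat i * s) p)) y / fact i"
    \<comment> \<open>The sum runs to \<open>Suc (degree p)\<close> so that index 1 is present even
      when \<open>p\<close> is constant.\<close>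
    have "\<bar>\<Sum>i\<le>Suc (degree p). ?\<alpha> i * c ^ i\<bar> \<le> B" for c
      using bd[of y "q + s" c] y assms(4) lc_nth_poly_shift[of p "Suc (degree p)" y c s "q + s"] by auto
    then have "?\<alpha> 1 = 0" by (rule bounded_polynomial_coeff_0) auto
    then show "poly (pderiv (level q p)) y = 0" by simp
  qed
  ultimately have "finite {u<..<v}" by (rule rev_finite_subset)
  then show False using assms(1) by (simp add: infinite_Ioo)
qed

text \<open>At exponent \<open>j t\<close> the coefficient of \<open>c ^ i\<close> comes from level
  \<open>(j - i) t\<close>. For \<open>i > j\<close> it vanishes by \<open>low\<close>, and for
  \<open>i = j\<close> it is the wanted derivative of level 0 divided by \<open>j!\<close>.
  Comparing coefficients with \<open>T\<close>, whose degree is at most \<open>n\<close>, gives the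
  limit.\<close>

lemma higher_pderiv_limit:
  assumes "0 < t"
    and low: "\<And>K q. q \<le> - t \<Longrightarrow> pderiv (level q (R K)) = 0"
    and "degree T \<le> n"
    and lim: "\<And>c. (\<lambda>K. lc_nth (poly (R K) (of_real y + of_real c * dpow t)) (of_nat j * t))
       \<longlonglongrightarrow> lc_nth (poly T (of_real c * dpow t)) (of_nat j * t)"
  shows "\<exists>L. (\<lambda>K. poly ((pderiv ^^ j) (level 0 (R K))) y) \<longlonglongrightarrow> L \<and> (n < j \<longrightarrow> L = 0)"
proof -
  define \<beta> where "\<beta> K i = poly ((pderiv ^^ i) (level (of_nat j * t - of_nat i * t) (R K))) y / fact i" for K i
  define \<gamma> where "\<gamma> i = poly ((pderiv ^^ i) (level (of_nat j * t - of_nat i * t) T)) 0 / fact i" for i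
  define m where "m = max j n"
  have \<beta>0: "\<beta> K i = 0" if "j < i" for K i
  proof -
    have "of_nat j + 1 \<le> (of_nat i :: rat)"
      using that by (metis Suc_leI of_nat_Suc of_nat_le_iff add.commute)
    then have "(of_nat j + 1) * t \<le> of_nat i * t" using assms(1) by (intro mult_right_mono) auto
    then have "pderiv (level (of_nat j * t - of_nat i * t) (R K)) = 0"
      by (intro low) (simp add: algebra_simps)
    moreover have "i \<noteq> 0" using that by simp
    then obtain i' where "i = Suc i'" using not0_implies_Suc by blast
    ultimately show ?thesis by (simp add: \<beta>_def funpow_Suc_right del: funpow.simps)
  qed
  have R: "lc_nth (poly (R K) (of_real y + of_real c * dpow t)) (of_nat j * t) = (\<Sum>i\<le>m. \<beta> K i * c ^ i)" for K c
  proof -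
    \<comment> \<open>The degree of \<open>R K\<close> may grow with \<open>K\<close>; the vanishing
      of \<open>\<beta>\<close> beyond \<open>j\<close> cuts the sum to the fixed length
      \<open>m\<close> that \<open>coeffs_tendsto_0\<close> needs.\<close>
    have "lc_nth (poly (R K) (of_real y + of_real c * dpow t)) (of_nat j * t) = (\<Sum>i\<le>max m (degree (R K)). \<beta> K i * c ^ i)"
      unfolding \<beta>_def by (rule lc_nth_poly_shift) simp
    also have "\<dots> = (\<Sum>i\<le>m. \<beta> K i * c ^ i)"
    proof (rule sum.mono_neutral_right)
      show "\<forall>i\<in>{..max m (degree (R K))} - {..m}. \<beta> K i * c ^ i = 0"
      proof
        fix i assume "i \<in> {..max m (degree (R K))} - {..m}"
        then have "j < i" by (auto simp: m_def)
        then show "\<beta> K i * c ^ i = 0" using \<beta>0 by simp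
      qed
    qed auto
    finally show ?thesis .
  qed
  have \<gamma>0: "\<gamma> i = 0" if "n < i" for i
  proof -
    have "(pderiv ^^ i) T = 0"
      using that assms(3) by (intro poly_eqI) (simp add: coeff_higher_pderiv coeff_eq_0)
    then have "level q ((pderiv ^^ i) T) = 0" for q by (simp add: level_def)
    then show ?thesis by (simp add: \<gamma>_def level_pderiv)
  qed
  have T: "lc_nth (poly T (of_real c * dpow t)) (of_nat j * t) = (\<Sum>i\<le>m. \<gamma> i * c ^ i)" for c
    unfolding \<gamma>_def using lc_nth_poly_shift[of T m 0 c t "of_nat j * t"] assms(3) by (simp add: m_def)
  have "(\<lambda>K. \<Sum>i\<le>m. (\<beta> K i - \<gamma> i) * c ^ i) \<longlonglongrightarrow> 0" for c
    using lim[of c] unfolding R T by (simp add: LIM_zero_iff left_diff_distrib sum_subtractf)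
  then have "(\<lambda>K. \<beta> K j - \<gamma> j) \<longlonglongrightarrow> 0"
    by (rule coeffs_tendsto_0[where \<alpha> = "\<lambda>K i. \<beta> K i - \<gamma> i"]) (simp add: m_def)
  then have "(\<lambda>K. \<beta> K j * fact j) \<longlonglongrightarrow> \<gamma> j * fact j"
    by (intro tendsto_mult_right) (simp add: LIM_zero_iff)
  then show ?thesis
    using \<gamma>0 by (intro exI[of _ "\<gamma> j * fact j"]) (simp add: \<beta>_def)
qed


text \<open>The first use of Baire, on real sequences, bounds the levels of negative exponent; the
  second, on the real line, bounds the derivative of order \<open>n + 1\<close> of level 0.\<close>

lemma weak_limit_is_polynomial:
  assumes "u0 < v0"
    and weak: "\<And>x. (\<And>q. q < 0 \<Longrightarrow> lc_nth x q = 0) \<Longrightarrow> u0 < lc_nth x 0 \<Longrightarrow> lc_nth x 0 < v0 \<Longrightarrow>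
      weakly_converges (\<lambda>K. poly (P K) x) (order_ext a b n f x)"
  shows "\<exists>u v r. u0 < u \<and> u < v \<and> v < v0 \<and> (\<forall>y\<in>{u..v}. f y = poly r y)"
proof -
  define V where "V = {c :: nat \<Rightarrow> real. u0 < c 0 \<and> c 0 < v0}"
  have decomp: "infinitesimal (x - of_real (lc_nth x 0))" if "\<And>q. q < 0 \<Longrightarrow> lc_nth x q = 0" for x
    using that by (auto simp: infinitesimal_iff le_less)
  have "open V"
    unfolding V_def by (intro open_Collect_conj open_Collect_less continuous_on_product_coordinates continuous_on_const)
  moreover obtain w where "u0 < w" "w < v0" using dense[OF assms(1)] by blast
  then have "(\<lambda>_. w) \<in> V" by (simp add: V_def)
  then have "V \<noteq> {}" by (metis empty_iff)
  moreover have "continuous_on UNIV (\<lambda>c. lc_nth (poly (P K) (from_coeffs c)) q)" for K q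
    using continuous_family_poly[OF continuous_family_from_coeffs, of "P K"]
    unfolding continuous_family_def by blast
  moreover have "\<exists>N. \<forall>K\<ge>N. \<forall>q\<in>{..<0}. \<bar>lc_nth (poly (P K) (from_coeffs c)) q\<bar> \<le> 1" if "c \<in> V" for c
  proof -
    let ?x = "from_coeffs c"
    have "lc_nth ?x 0 = c 0" using from_coeffs_nth[of c 0] by simp
    then have "weakly_converges (\<lambda>K. poly (P K) ?x) (order_ext a b n f ?x)"
      using that from_coeffs_neg by (intro weak) (auto simp: V_def)
    from weak_uniform_below[OF this] obtain N where
      N: "\<forall>K\<ge>N. \<forall>q<0. \<bar>lc_nth (poly (P K) ?x - order_ext a b n f ?x) q\<bar> \<le> 1" by blast
    moreover have "lc_nth (order_ext a b n f ?x) q = 0" if "q < 0" for q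
      using order_ext_nth(1)[OF decomp[OF from_coeffs_neg] that, of a b n f "lc_nth ?x 0" c] by simp
    ultimately show ?thesis by (intro exI[of _ N]) auto
  qed
  ultimately obtain W N where W: "open W" "W \<noteq> {}" "W \<subseteq> V"
    "\<And>c K q. c \<in> W \<Longrightarrow> N \<le> K \<Longrightarrow> q \<in> {..<0} \<Longrightarrow> \<bar>lc_nth (poly (P K) (from_coeffs c)) q\<bar> \<le> 1"
    using Baire_uniform_bound[of V "{..<0}" "\<lambda>K q c. lc_nth (poly (P K) (from_coeffs c)) q" 1] by metis
  obtain c where "c \<in> W" using W(2) by (metis ex_in_conv)
  then obtain X where X: "c \<in> (\<Pi>\<^sub>E i\<in>UNIV. X i)" "\<And>i. open (X i)" "finite {i. X i \<noteq> UNIV}"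
      "(\<Pi>\<^sub>E i\<in>UNIV. X i) \<subseteq> W"
    using product_topology_open_contains_basis[of "\<lambda>_. euclidean" UNIV W c] W(1)
    unfolding open_fun_def by auto
  \<comment> \<open>A coordinate that the open box leaves free; coordinate 0 is excluded since it
    carries the real part.\<close>
  obtain s where "s \<notin> insert 0 {i. X i \<noteq> UNIV}"
    using ex_new_if_finite[OF infinite_UNIV_nat] X(3) by (metis finite_insert)
  then have s: "0 < s" "X s = UNIV" by auto
  obtain e where e: "0 < e" "ball (c 0) e \<subseteq> X 0"
    using X(1,2) open_contains_ball by (metis PiE_mem UNIV_I)
  define u v where "u = c 0 - e" and "v = c 0 + e"
  have "u < v" using e(1) by (simp add: u_def v_def)
  have inW: "c(0 := y, s := \<gamma>) \<in> W" if "u < y" "y < v" for y \<gamma>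
  proof -
    have "y \<in> X 0" using that e(2) by (auto simp: u_def v_def dist_real_def)
    then have "c(0 := y, s := \<gamma>) \<in> (\<Pi>\<^sub>E i\<in>UNIV. X i)"
      using X(1) s by (auto simp: PiE_iff)
    then show ?thesis using X(4) by blast
  qed
  have uv: "u0 < y" "y < v0" if "u < y" "y < v" for y
    using inW[OF that, of 0] W(3) s(1) by (auto simp: V_def)
  define \<xi> where "\<xi> = from_coeffs (c(0 := 0, s := 0))"
  have \<xi>: "infinitesimal \<xi>"
    using decomp[OF from_coeffs_neg, of "c(0 := 0, s := 0)"] from_coeffs_nth[of "c(0 := 0, s := 0)" 0] s(1)
    by (simp add: \<xi>_def)
  \<comment> \<open>Dropping the first \<open>N\<close> indices makes the bound hold for all
    \<open>K\<close>; the shift by \<open>\<xi>\<close> leaves only real \<open>y\<close> and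
    \<open>\<gamma>\<close> as variables.\<close>
  define R where "R K = pcompose (P (K + N)) [:\<xi>, 1:]" for K
  have R: "poly (R K) x = poly (P (K + N)) (\<xi> + x)" for K x
    by (simp add: R_def poly_pcompose)
  \<comment> \<open>Taking \<open>t\<close> above \<open>s\<close> turns the strict bound
    \<open>q < - s\<close> into the bound \<open>q \<le> - t\<close> required by
    \<open>higher_pderiv_limit\<close>.\<close>
  define t where "t = of_nat s + (1 :: rat)"
  have "0 < t" unfolding t_def by (intro add_nonneg_pos) auto
  have low: "pderiv (level q (R K)) = 0" if "q \<le> - t" for K q
  proof (rule level_pderiv_eq_0[OF \<open>u < v\<close>])
    show "\<bar>lc_nth (poly (R K) (of_real y + of_real \<gamma> * dpow (of_nat s))) q\<bar> \<le> 1"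
      if "u < y" "y < v" "q < 0" for y \<gamma> q
    proof -
      have "from_coeffs (c(0 := y, s := \<gamma>)) = \<xi> + (of_real y + of_real \<gamma> * dpow (of_nat s))"
        unfolding \<xi>_def by (rule trans[OF from_coeffs_upd[OF s(1)] add.commute])
      then show ?thesis
        using W(4)[OF inW[OF that(1,2), of \<gamma>], of "K + N" q] that(3) by (simp add: R)
    qed
  qed (use that s(1) in \<open>auto simp: t_def\<close>)
  have lim: "weakly_converges (\<lambda>K. poly (R K) (of_real y + of_real \<gamma> * dpow t))
      (order_ext a b n f (of_real y + (\<xi> + of_real \<gamma> * dpow t)))"
    if "u < y" "y < v" for y \<gamma>
  proof -
    let ?x = "of_real y + (\<xi> + of_real \<gamma> * dpow t)"
    have "infinitesimal (\<xi> + of_real \<gamma> * dpow t)"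
      using \<xi> \<open>0 < t\<close> by (auto simp: infinitesimal_iff)
    then have "lc_nth ?x q = 0" if "q < 0" for q
      using that by (simp add: infinitesimal_iff del: plus_levi_civita.rep_eq) (simp add: infinitesimal_iff)
    moreover have "lc_nth ?x 0 = y" using \<xi> \<open>0 < t\<close> by (auto simp: infinitesimal_iff)
    ultimately have "weakly_converges (\<lambda>K. poly (P K) ?x) (order_ext a b n f ?x)"
      using uv[OF that] by (intro weak) auto
    from weakly_converges_shift[OF this, of N] show ?thesis by (simp add: R add_ac)
  qed
  have L: "\<exists>L. (\<lambda>K. poly ((pderiv ^^ j) (level 0 (R K))) y) \<longlonglongrightarrow> L \<and> (n < j \<longrightarrow> L = 0)"
    if y: "u < y" "y < v" for j y
  proof (rule higher_pderiv_limit[OF \<open>0 < t\<close> low])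
    \<comment> \<open>The defining sum of the order \<open>n\<close> extension around
      \<open>y\<close>, as a polynomial in the increment beyond \<open>y + \<xi>\<close>.\<close>
    define T where "T = pcompose (\<Sum>i\<le>n. monom (of_real (nth_deriv_within {a..b} i f y) / fact i) i) [:\<xi>, 1:]"
    show "degree T \<le> n"
      unfolding T_def by (auto simp: degree_pcompose intro!: degree_sum_le order_trans[OF degree_monom_le])
    fix \<gamma>
    have "infinitesimal (\<xi> + of_real \<gamma> * dpow t)"
      using \<xi> \<open>0 < t\<close> by (auto simp: infinitesimal_iff)
    then have "order_ext a b n f (of_real y + (\<xi> + of_real \<gamma> * dpow t)) = poly T (of_real \<gamma> * dpow t)"
      by (simp add: order_ext_eq T_def poly_pcompose poly_sum poly_monom)
    then show "(\<lambda>K. lc_nth (poly (R K) (of_real y + of_real \<gamma> * dpow t)) (of_nat j * t))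
       \<longlonglongrightarrow> lc_nth (poly T (of_real \<gamma> * dpow t)) (of_nat j * t)"
      using weak_pointwise[OF lim[OF y, of \<gamma>]] by (simp only:)
  qed
  define g where "g j y = lim (\<lambda>K. poly ((pderiv ^^ j) (level 0 (R K))) y)" for j y
  have g: "(\<lambda>K. poly ((pderiv ^^ j) (level 0 (R K))) y) \<longlonglongrightarrow> g j y" "n < j \<Longrightarrow> g j y = 0"
    if y: "u < y" "y < v" for j y
  proof -
    obtain L where "(\<lambda>K. poly ((pderiv ^^ j) (level 0 (R K))) y) \<longlonglongrightarrow> L" "n < j \<longrightarrow> L = 0"
      using L[OF y] by blast
    moreover from this(1) have "g j y = L" unfolding g_def by (rule limI)
    ultimately show "(\<lambda>K. poly ((pderiv ^^ j) (level 0 (R K))) y) \<longlonglongrightarrow> g j y" "n < j \<Longrightarrow> g j y = 0"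
      by simp_all
  qed
  have g0: "g 0 y = f y" if y: "u < y" "y < v" for y
  proof (rule LIMSEQ_unique)
    show "(\<lambda>K. poly (level 0 (R K)) y) \<longlonglongrightarrow> g 0 y" using g(1)[OF y, of 0] by simp
    show "(\<lambda>K. poly (level 0 (R K)) y) \<longlonglongrightarrow> f y"
      using weak_pointwise[OF lim[OF y, of 0], of 0] order_ext_nth(2)[OF \<xi>] by (simp add: poly_level)
  qed
  \<comment> \<open>The one-point type \<open>unit\<close> serves as index set, as only one function
    per \<open>K\<close> is to be bounded.\<close>
  have bound: "\<exists>N. \<forall>K\<ge>N. \<forall>q\<in>(UNIV :: unit set). \<bar>poly ((pderiv ^^ Suc n) (level 0 (R K))) y\<bar> \<le> 1"
    if "y \<in> {u<..<v}" for y
  proof -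
    have "(\<lambda>K. poly ((pderiv ^^ Suc n) (level 0 (R K))) y) \<longlonglongrightarrow> 0"
      using g(1)[of y "Suc n"] g(2)[of y "Suc n"] that by auto
    from LIMSEQ_D[OF this, of 1] show ?thesis by (auto simp del: funpow.simps intro: less_imp_le)
  qed
  obtain W2 N2 where W2: "open W2" "W2 \<noteq> {}" "W2 \<subseteq> {u<..<v}"
    "\<And>y K q. y \<in> W2 \<Longrightarrow> N2 \<le> K \<Longrightarrow> q \<in> (UNIV :: unit set) \<Longrightarrow>
      \<bar>poly ((pderiv ^^ Suc n) (level 0 (R K))) y\<bar> \<le> 1"
  proof (rule Baire_uniform_bound[where h = "\<lambda>K _. poly ((pderiv ^^ Suc n) (level 0 (R K)))"])
    show "{u<..<v} \<noteq> {}" using \<open>u < v\<close> by simp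
    show "continuous_on UNIV (poly ((pderiv ^^ Suc n) (level 0 (R K))))" for K
      by (intro continuous_intros)
  qed (rule open_greaterThanLessThan bound that; assumption)+
  obtain z where "z \<in> W2" using W2(2) by blast
  then obtain d where d: "0 < d" "cball z d \<subseteq> W2" using W2(1) open_contains_cball by blast
  let ?I = "{z - d..z + d}"
  have I: "y \<in> W2" "u < y" "y < v" if "y \<in> ?I" for y
  proof -
    show "y \<in> W2" using that d(2) by (auto simp: cball_eq_atLeastAtMost)
    then have "y \<in> {u<..<v}" using W2(3) by blast
    then show "u < y" "y < v" by auto
  qed
  have "\<exists>r B. \<forall>y\<in>?I. g 0 y = poly r y \<and> (\<forall>K. \<bar>poly (level 0 (R (K + N2))) y\<bar> \<le> B)"
  proof (rule limit_of_polynomials)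
    show "(\<lambda>K. poly ((pderiv ^^ j) (level 0 (R (K + N2)))) y) \<longlonglongrightarrow> g j y" if "y \<in> ?I" for j y
      using g(1)[OF I(2,3)[OF that]] by (rule LIMSEQ_ignore_initial_segment)
    show "g (Suc n) y = 0" if "y \<in> ?I" for y using g(2)[OF I(2,3)[OF that]] by simp
    show "\<bar>poly ((pderiv ^^ Suc n) (level 0 (R (K + N2)))) y\<bar> \<le> 1" if "y \<in> ?I" for K y
      using W2(4)[OF I(1)[OF that], of "K + N2" "()"] by (simp del: funpow.simps)
  qed (use d in auto)
  then obtain r where "\<forall>y\<in>?I. f y = poly r y" using g0 I by metis
  moreover have "u0 < z - d" "z + d < v0"
    using uv I(2,3)[of "z - d"] I(2,3)[of "z + d"] d(1) by auto
  ultimately show ?thesis using d(1) by (intro exI[of _ "z - d"] exI[of _ "z + d"] exI[of _ r]) auto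
qed

theorem lemma3p17:
  fixes a b :: real and n :: nat and f :: "real \<Rightarrow> real" and A :: "levi_civita set"
  assumes "a < b"
    and "C_n_on n {a..b} f"
    and "\<forall>r\<in>{a..b}. \<not> locally_analytic_within {a..b} f r"
    and "lc_measurable A"
    and "A \<subseteq> {of_real a..of_real b}"
    and "\<not> infinitesimal (lc_measure A)"
  shows "order_ext a b n f \<notin> lc_measurable_funs A"
proof
  assume "order_ext a b n f \<in> lc_measurable_funs A"
  from noninfinitesimal_interval[OF assms(4-6) this] obtain I u0 v0 where
    I: "simple_on I (order_ext a b n f)" "u0 < v0" "a \<le> u0" "v0 \<le> b"
      "\<And>x. (\<And>q. q < 0 \<Longrightarrow> lc_nth x q = 0) \<Longrightarrow> u0 < lc_nth x 0 \<Longrightarrow> lc_nth x 0 < v0 \<Longrightarrow> x \<in> I"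
    by metis
  obtain x0 c where c: "\<And>x. x \<in> I \<Longrightarrow> weakly_converges (\<lambda>K. \<Sum>k\<le>K. c k * (x - x0) ^ k) (order_ext a b n f x)"
    using I(1) unfolding simple_on_def by blast
  \<comment> \<open>The partial sums as polynomials in \<open>x\<close>; the centre
    \<open>x0\<close> is absorbed into their coefficients.\<close>
  define P where "P K = (\<Sum>k\<le>K. smult (c k) ([:- x0, 1:] ^ k))" for K :: nat
  have P: "poly (P K) x = (\<Sum>k\<le>K. c k * (x - x0) ^ k)" for K x
    by (simp add: P_def poly_sum)
  obtain u v r where uvr: "u0 < u" "u < v" "v < v0" "\<forall>y\<in>{u..v}. f y = poly r y"
    using weak_limit_is_polynomial[OF I(2), of P a b n f] c I(5) unfolding P by metis
  define y where "y = (u + v) / 2"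
  have "f x = poly r x" if "\<bar>x - y\<bar> < (v - u) / 2" for x
  proof -
    have "x - y < (v - u) / 2" "y - x < (v - u) / 2" using that by linarith+
    moreover have "2 * y = u + v" by (simp add: y_def)
    ultimately have "u \<le> x" "x \<le> v" by (simp_all add: field_simps)
    then have "x \<in> {u..v}" by simp
    then show ?thesis using uvr(4) by blast
  qed
  then have "locally_analytic_within {a..b} f y"
    by (rule polynomial_locally_analytic[where \<delta> = "(v - u) / 2"]) (use uvr(2) in simp_all)
  moreover have "y \<in> {a..b}" using uvr(1-3) I(3,4) by (auto simp: y_def)
  ultimately show False using assms(3) by blast
qed

end
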